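(* Let $n\geqslant 2$ be an integer. The monoid $\mathcal{PIO}_{n}$ is defined by the presentation $\langle A\cup B\cup E\cup F\mid \bar R\rangle$ on the $4n-4$ generators $A=\{a_1,\ldots,a_{n-1}\}$, $B=\{b_1,\ldots,b_{n-1}\}$, $E=\{e_1,\ldots,e_{n-1}\}$, $F=\{f_2,\ldots,f_n\}$ and the $5n^2+3n-10$ relations $\bar R=R_1\cup R_{1b}\cup R_2\cup R_3\cup R_4\cup R_{4b}\cup R_5\cup R_{5b}\cup R_6\cup R_{6b}\cup R_7$, where: $(R_1)$ $a_ia_{n-1}=a_i$ for $1\leqslant i\leqslant n-1$; $a_ia_j=a_{j+1}a_i$ for $1\leqslant i\leqslant j\leqslant n-2$. $(R_{1b})$ $b_ib_1=b_i$ for $1\leqslant i\leqslant n-1$; $b_ib_{j+1}=b_{j+1}b_{i+1}$ for $1\leqslant i\leqslant j\leqslant n-2$. $(R_2)$ $e_i^2=e_i$ and $f_{i+1}^2=f_{i+1}$ for $1\leqslant i\leqslant n-1$. $(R_3)$ $e_if_j=f_je_i$ for $2\leqslant j\leqslant i\leqslant n-1$; $e_if_{i+1}=f_{i+1}e_i=e_1f_n$ for $1\leqslant i\leqslant n-1$; $e_ie_{i+1}=e_{i+1}e_i=e_i$ for $1\leqslant i\leqslant n-2$; $f_if_{i+1}=f_{i+1}f_i=f_{i+1}$ for $2\leqslant i\leqslant n-1$. $(R_4)$ $a_ie_{i-1}=e_{i-1}$ for $2\leqslant i\leqslant n-1$; $a_ie_j=e_{j+1}a_i$ for $1\leqslant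 i\leqslant j\leqslant n-2$; $a_{n-1}e_{n-1}=a_{n-1}$; $e_ia_i=e_i$ for $1\leqslant i\leqslant n-1$. $(R_{4b})$ $b_if_{i+2}=f_{i+2}$ for $1\leqslant i\leqslant n-2$; $b_if_{j+1}=f_jb_i$ for $2\leqslant j\leqslant i\leqslant n-1$; $b_1f_2=b_1$; $f_{i+1}b_i=f_{i+1}$ for $1\leqslant i\leqslant n-1$. $(R_5)$ $a_if_j=f_ja_i$ for $2\leqslant j\leqslant i\leqslant n-1$; $a_if_j=f_{j+1}a_i$ for $1\leqslant i<j\leqslant n-1$; $a_1f_n=e_1f_n$ and $a_{n-1}f_n=e_1f_n$. $(R_{5b})$ $b_ie_j=e_jb_i$ for $1\leqslant i<j\leqslant n-1$; $b_ie_j=e_{j-1}b_i$ for $2\leqslant j\leqslant i\leqslant n-1$; $b_1e_1=f_ne_1$ and $b_{n-1}e_1=f_ne_1$. $(R_6)$ $f_{i+1}a_i=f_{i+1}a_1$ for $2\leqslant i\leqslant n-1$. $(R_{6b})$ $e_ib_i=e_ib_{n-1}$ for $1\leqslant i\leqslant n-2$. $(R_7)$ $b_ia_j=a_jb_i$ for $1\leqslant i<j\leqslant n-1$; $b_ia_1=a_i$ for $1\leqslant i\leqslant n-1$; $a_ib_{n-1}=b_i$ for $1\leqslant i\leqslant n-1$.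
   Context: $\Omega_n=\{1,\ldots,n\}$ with its natural order. A partial transformation of $\Omega_n$ is a map $\alpha$ from a subset $\operatorname{Dom}(\alpha)\subseteq\Omega_n$ (possibly empty) into $\Omega_n$, with image $\operatorname{Im}(\alpha)$. Maps are written on the right and composed from left to right: $x(\alpha\beta)=(x\alpha)\beta$, with $\operatorname{Dom}(\alpha\beta)=\{x\in\operatorname{Dom}(\alpha)\mid x\alpha\in\operatorname{Dom}(\beta)\}$. $\alpha$ is order-preserving if $x\leqslant y$ implies $x\alpha\leqslant y\alpha$ for all $x,y\in\operatorname{Dom}(\alpha)$. A subset $I\subseteq\Omega_n$ (possibly empty) is an interval if for all $x,y,z\in\Omega_n$, $x\leqslant y\leqslant z$ and $x,z\in I$ imply $y\in I$. $\mathcal{PIO}_n$ is the monoid, under composition, of all order-preserving partial transformations $\alpha$ of $\Omega_n$ such that $\operatorname{Dom}(\alpha)$ and $\operatorname{Im}(\alpha)$ are both intervals of $\Omega_n$ (it includes the empty transformation). For an alphabet $X$, $X^*$ is the free monoid on $X$. For $R\subseteq X^*\times X^*$ (a pair $(u,v)\in R$ being written $u=v$), $\sim_R$ is the smallest congruence on $X^*$ containing $R$. A monoid $M$ is defined by the presentation $\langle X\mid R\rangle$ if $M$ is isomorphic to $X^*/{\sim_R}$. In the presentation, the elements of $A\cup B\cup E\cup F$ are regarded as $4n-4$ distinct formal letters. (They are named after generators of $\mathcal{PIO}_n$: for $1\leqslant i\leqslant n-1$, $a_i$ is the full transformation with $xa_i=x$ for $x\leqslant i$ and $xa_i=x-1$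 for $x\geqslant i+1$; $b_i$ is the full transformation with $xb_i=x+1$ for $x\leqslant i$ and $xb_i=x$ for $x\geqslant i+1$; $e_i$ is the identity map on $\{1,\ldots,i\}$; $f_{i+1}$ is the identity map on $\{i+1,\ldots,n\}$.) The number of relations is counted as listed, a chain $u=v=w$ counting as two relations. *)

theory Defs
  imports "HOL-Algebra.Group"
begin

section \<open>Monoid presentations\<close>

definition free_monoid :: "'x set \<Rightarrow> 'x list monoid" where
  "free_monoid X = \<lparr>carrier = lists X, mult = (@), one = []\<rparr>"

definition congruence :: "('a, 'b) monoid_scheme \<Rightarrow> ('a \<times> 'a) set \<Rightarrow> bool" where
  "congruence M r \<longleftrightarrow> equiv (carrier M) r \<and>
     (\<forall>(x, x') \<in> r. \<forall>(y, y') \<in> r. (x \<otimes>\<^bsub>M\<^esub> y, x' \<otimes>\<^bsub>M\<^esub> y') \<in> r)"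

text \<open>For \<open>R \<subseteq> carrier M \<times> carrier M\<close> this is the smallest congruence containing \<open>R\<close>;
  see \<open>congruence_generated_congruence\<close> and the two facts after it.\<close>

definition generated_congruence :: "('a, 'b) monoid_scheme \<Rightarrow> ('a \<times> 'a) set \<Rightarrow> ('a \<times> 'a) set" where
  "generated_congruence M R = \<Inter> {r. congruence M r \<and> R \<subseteq> r}"

text \<open>The product of two classes \<open>U\<close>, \<open>V\<close> is the class of \<open>u \<otimes> v\<close> for any \<open>u \<in> U\<close>, \<open>v \<in> V\<close>;
  see \<open>quotient_monoid_mult\<close>.\<close>

definition quotient_monoid :: "('a, 'b) monoid_scheme \<Rightarrow> ('a \<times> 'a) set \<Rightarrow> 'a set monoid" where
  "quotient_monoid M r =
     \<lparr>carrier = carrier M // r,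
      mult = (\<lambda>U V. \<Union>u\<in>U. \<Union>v\<in>V. r `` {u \<otimes>\<^bsub>M\<^esub> v}),
      one = r `` {\<one>\<^bsub>M\<^esub>}\<rparr>"

text \<open>\<open>(\<cong>)\<close> only requires a bijection compatible with products; between monoids such a map also
  preserves the identity.\<close>

definition defined_by_presentation ::
    "('a, 'b) monoid_scheme \<Rightarrow> 'x set \<Rightarrow> ('x list \<times> 'x list) set \<Rightarrow> bool" where
  "defined_by_presentation M X R \<longleftrightarrow>
     monoid M \<and> R \<subseteq> lists X \<times> lists X \<and>
     M \<cong> quotient_monoid (free_monoid X) (generated_congruence (free_monoid X) R)"

lemma congruence_generated_congruence:
  assumes "monoid M" and "R \<subseteq> carrier M \<times> carrier M"
  shows "congruence M (generated_congruence M R)"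
proof -
  have full: "congruence M (carrier M \<times> carrier M)"
    using assms(1) by (auto simp: congruence_def equiv_def refl_on_def sym_def trans_def monoid.m_closed)
  show ?thesis
    unfolding congruence_def
  proof (intro conjI)
    show "equiv (carrier M) (generated_congruence M R)"
    proof (rule equivI)
      show "generated_congruence M R \<subseteq> carrier M \<times> carrier M"
        using full assms(2) by (auto simp: generated_congruence_def)
      show "refl_on (carrier M) (generated_congruence M R)"
        by (auto simp: generated_congruence_def congruence_def equiv_def refl_on_def)
      show "sym (generated_congruence M R)"
        unfolding generated_congruence_def congruence_def equiv_def sym_def by blast
      show "trans (generated_congruence M R)"
        unfolding generated_congruence_def congruence_def equiv_def trans_def by blast
    qed
    show "\<forall>(x, x') \<in> generated_congruence M R. \<forall>(y, y') \<in> generated_congruence M R.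
            (x \<otimes>\<^bsub>M\<^esub> y, x' \<otimes>\<^bsub>M\<^esub> y') \<in> generated_congruence M R"
    proof (clarify)
      fix x x' y y'
      assume a: "(x, x') \<in> generated_congruence M R" "(y, y') \<in> generated_congruence M R"
      have "(x \<otimes>\<^bsub>M\<^esub> y, x' \<otimes>\<^bsub>M\<^esub> y') \<in> r" if r: "congruence M r" "R \<subseteq> r" for r
      proof -
        have "(x, x') \<in> r" "(y, y') \<in> r"
          using a r by (simp_all add: generated_congruence_def)
        moreover have "\<forall>p\<in>r. \<forall>q\<in>r. (fst p \<otimes>\<^bsub>M\<^esub> fst q, snd p \<otimes>\<^bsub>M\<^esub> snd q) \<in> r"
          using r(1) by (simp add: congruence_def case_prod_beta)
        ultimately show ?thesis
          by (metis fst_conv snd_conv)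
      qed
      then show "(x \<otimes>\<^bsub>M\<^esub> y, x' \<otimes>\<^bsub>M\<^esub> y') \<in> generated_congruence M R"
        by (simp add: generated_congruence_def)
    qed
  qed
qed

lemma subset_generated_congruence: "R \<subseteq> generated_congruence M R"
  by (auto simp: generated_congruence_def)

lemma generated_congruence_least:
  "congruence M r \<Longrightarrow> R \<subseteq> r \<Longrightarrow> generated_congruence M R \<subseteq> r"
  by (auto simp: generated_congruence_def)

lemma quotient_monoid_mult:
  assumes "congruence M r" "x \<in> carrier M" "y \<in> carrier M"
  shows "r `` {x} \<otimes>\<^bsub>quotient_monoid M r\<^esub> r `` {y} = r `` {x \<otimes>\<^bsub>M\<^esub> y}"
proof -
  have eq: "equiv (carrier M) r"
    using assms(1) by (simp add: congruence_def)
  have "r `` {u \<otimes>\<^bsub>M\<^esub> v} = r `` {x \<otimes>\<^bsub>M\<^esub> y}" if "(x, u) \<in> r" "(y, v) \<in> r" for u v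
    using that assms(1) eq by (intro equiv_class_eq[symmetric, OF eq]) (auto simp: congruence_def)
  moreover have "x \<in> r `` {x}" "y \<in> r `` {y}"
    using equiv_class_self[OF eq] assms(2,3) by auto
  ultimately show ?thesis
    unfolding quotient_monoid_def monoid.simps by blast
qed


section \<open>The monoid of order-preserving partial transformations with interval domain and image\<close>

definition is_interval_of :: "nat \<Rightarrow> nat set \<Rightarrow> bool" where
  "is_interval_of n I \<longleftrightarrow> I \<subseteq> {1..n} \<and>
     (\<forall>x\<in>{1..n}. \<forall>y\<in>{1..n}. \<forall>z\<in>{1..n}. x \<le> y \<and> y \<le> z \<and> x \<in> I \<and> z \<in> I \<longrightarrow> y \<in> I)"

definition PIO_carrier :: "nat \<Rightarrow> (nat \<rightharpoonup> nat) set" where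
  "PIO_carrier n = {\<alpha>. dom \<alpha> \<subseteq> {1..n} \<and> ran \<alpha> \<subseteq> {1..n} \<and>
     mono_on (dom \<alpha>) (\<lambda>x. the (\<alpha> x)) \<and>
     is_interval_of n (dom \<alpha>) \<and> is_interval_of n (ran \<alpha>)}"

text \<open>Maps are composed from left to right, whereas \<open>\<beta> \<circ>\<^sub>m \<alpha>\<close> applies \<open>\<alpha>\<close> first.\<close>

definition PIO :: "nat \<Rightarrow> (nat \<rightharpoonup> nat) monoid" where
  "PIO n = \<lparr>carrier = PIO_carrier n, mult = (\<lambda>\<alpha> \<beta>. \<beta> \<circ>\<^sub>m \<alpha>), one = Some |` {1..n}\<rparr>"


section \<open>Generators and relations\<close>

datatype letter = ga nat | gb nat | ge nat | gf nat

definition letters :: "nat \<Rightarrow> letter set" where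
  "letters n = ga ` {1..n - 1} \<union> gb ` {1..n - 1} \<union> ge ` {1..n - 1} \<union> gf ` {2..n}"

type_synonym relation = "letter list \<times> letter list"

text \<open>The relations are kept as lists so that they can be counted as listed: for \<open>n = 2\<close> some
  of them coincide as pairs of words. A chain \<open>u = v = w\<close> contributes \<open>(u, v)\<close> and \<open>(v, w)\<close>.\<close>

definition R1 :: "nat \<Rightarrow> relation list" where
  "R1 n =
     [([ga i, ga (n - 1)], [ga i]). i \<leftarrow> [1..<n]] @
     [([ga i, ga j], [ga (j + 1), ga i]). i \<leftarrow> [1..<n - 1], j \<leftarrow> [i..<n - 1]]"

definition R1b :: "nat \<Rightarrow> relation list" where
  "R1b n =
     [([gb i, gb 1], [gb i]). i \<leftarrow> [1..<n]] @
     [([gb i, gb (j + 1)], [gb (j + 1), gb (i + 1)]). i \<leftarrow> [1..<n - 1], j \<leftarrow> [i..<n - 1]]"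

definition R2 :: "nat \<Rightarrow> relation list" where
  "R2 n =
     [([ge i, ge i], [ge i]). i \<leftarrow> [1..<n]] @
     [([gf (i + 1), gf (i + 1)], [gf (i + 1)]). i \<leftarrow> [1..<n]]"

definition R3 :: "nat \<Rightarrow> relation list" where
  "R3 n =
     [([ge i, gf j], [gf j, ge i]). i \<leftarrow> [2..<n], j \<leftarrow> [2..<i + 1]] @
     [([ge i, gf (i + 1)], [gf (i + 1), ge i]). i \<leftarrow> [1..<n]] @
     [([gf (i + 1), ge i], [ge 1, gf n]). i \<leftarrow> [1..<n]] @
     [([ge i, ge (i + 1)], [ge (i + 1), ge i]). i \<leftarrow> [1..<n - 1]] @
     [([ge (i + 1), ge i], [ge i]). i \<leftarrow> [1..<n - 1]] @
     [([gf i, gf (i + 1)], [gf (i + 1), gf i]). i \<leftarrow> [2..<n]] @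
     [([gf (i + 1), gf i], [gf (i + 1)]). i \<leftarrow> [2..<n]]"

definition R4 :: "nat \<Rightarrow> relation list" where
  "R4 n =
     [([ga i, ge (i - 1)], [ge (i - 1)]). i \<leftarrow> [2..<n]] @
     [([ga i, ge j], [ge (j + 1), ga i]). i \<leftarrow> [1..<n - 1], j \<leftarrow> [i..<n - 1]] @
     [([ga (n - 1), ge (n - 1)], [ga (n - 1)])] @
     [([ge i, ga i], [ge i]). i \<leftarrow> [1..<n]]"

definition R4b :: "nat \<Rightarrow> relation list" where
  "R4b n =
     [([gb i, gf (i + 2)], [gf (i + 2)]). i \<leftarrow> [1..<n - 1]] @
     [([gb i, gf (j + 1)], [gf j, gb i]). i \<leftarrow> [2..<n], j \<leftarrow> [2..<i + 1]] @
     [([gb 1, gf 2], [gb 1])] @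
     [([gf (i + 1), gb i], [gf (i + 1)]). i \<leftarrow> [1..<n]]"

definition R5 :: "nat \<Rightarrow> relation list" where
  "R5 n =
     [([ga i, gf j], [gf j, ga i]). i \<leftarrow> [2..<n], j \<leftarrow> [2..<i + 1]] @
     [([ga i, gf j], [gf (j + 1), ga i]). i \<leftarrow> [1..<n], j \<leftarrow> [i + 1..<n]] @
     [([ga 1, gf n], [ge 1, gf n]), ([ga (n - 1), gf n], [ge 1, gf n])]"

definition R5b :: "nat \<Rightarrow> relation list" where
  "R5b n =
     [([gb i, ge j], [ge j, gb i]). i \<leftarrow> [1..<n], j \<leftarrow> [i + 1..<n]] @
     [([gb i, ge j], [ge (j - 1), gb i]). i \<leftarrow> [2..<n], j \<leftarrow> [2..<i + 1]] @
     [([gb 1, ge 1], [gf n, ge 1]), ([gb (n - 1), ge 1], [gf n, ge 1])]"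

definition R6 :: "nat \<Rightarrow> relation list" where
  "R6 n = [([gf (i + 1), ga i], [gf (i + 1), ga 1]). i \<leftarrow> [2..<n]]"

definition R6b :: "nat \<Rightarrow> relation list" where
  "R6b n = [([ge i, gb i], [ge i, gb (n - 1)]). i \<leftarrow> [1..<n - 1]]"

definition R7 :: "nat \<Rightarrow> relation list" where
  "R7 n =
     [([gb i, ga j], [ga j, gb i]). i \<leftarrow> [1..<n], j \<leftarrow> [i + 1..<n]] @
     [([gb i, ga 1], [ga i]). i \<leftarrow> [1..<n]] @
     [([ga i, gb (n - 1)], [gb i]). i \<leftarrow> [1..<n]]"

definition relations :: "nat \<Rightarrow> relation list" where
  "relations n = R1 n @ R1b n @ R2 n @ R3 n @ R4 n @ R4b n @ R5 n @ R5b n @ R6 n @ R6b n @ R7 n"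

end

theory Submission
  imports Defs
begin

text \<open>
Write s for the letter a_1 and t for b_(n-1). As transformations, s shifts every point one
step down (fixing 1) and t shifts every point one step up (fixing n). A nonempty
element of the monoid is determined by its domain, an interval {p,...,q}, by the image r of p,
and by the set K of those k in {p,...,q-1} for which k and k + 1 have the same image: since
the image is an interval, any other consecutive points have consecutive images. Such an element is
the value of the normal word
  f_p e_q a_(k1) a_(k2) ... a_(km) s^(p-1) t^(r-1),
where k1 > k2 > ... > km are the elements of K and f_1 and e_n stand for the empty word: the
product of the a's, the largest index first, performs the collapses without moving p, the powers
of s and t then move the image of p from p to 1 and on to r. The empty transformation is the
value of e_1 f_n.

Evaluation is therefore injective on normal words and reaches every element of the monoid
(\<open>eval_inj_on_normal_words\<close>, \<open>PIO_carrier_is_eval_normal\<close>). As the relations hold for the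
transformations (\<open>relations_sound\<close>), what remains is that the relations rewrite every word to a
normal word (\<open>all_reducible\<close>). By induction on the word, this reduces to multiplying a normal word
from the left by one letter. The relations b_i = a_i t leave only the letters a_i, e_i, f_i
and t, and each of them is pushed through the normal word from left to right
(\<open>reducible_a\<close>, \<open>reducible_e\<close>, \<open>reducible_f\<close>, \<open>reducible_b_last\<close>).

The rewriting takes place in an arbitrary set on which the letters act from the left in such
a way that the relations hold, so that a relation becomes an equation between
compositions of unary operators. The conclusions are then read off in the left action of
the letters on sets of congruent words.
\<close>

section \<open>Normal words\<close>

definition normal_word :: "nat \<Rightarrow> nat \<Rightarrow> nat \<Rightarrow> nat list \<Rightarrow> nat \<Rightarrow> letter list" where
  "normal_word n p q ks r =
     (if p = 1 then [] else [gf p]) @ (if q = n then [] else [ge q]) @ map ga ks @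
     replicate (p - 1) (ga 1) @ replicate (r - 1) (gb (n - 1))"

text \<open>The last inequality says that the image, which starts at r and has as many points as the
domain has steps not listed in ks, plus one, does not exceed n; otherwise the power of t
would collapse further points.\<close>

definition normal_params :: "nat \<Rightarrow> nat \<Rightarrow> nat \<Rightarrow> nat list \<Rightarrow> nat \<Rightarrow> bool" where
  "normal_params n p q ks r \<longleftrightarrow>
     1 \<le> p \<and> p \<le> q \<and> q \<le> n \<and> sorted_wrt (>) ks \<and> set ks \<subseteq> {p..<q} \<and>
     1 \<le> r \<and> r + (q - p) \<le> n + length ks"

definition normal_words :: "nat \<Rightarrow> letter list set" where
  "normal_words n =
     insert [ge 1, gf n] {normal_word n p q ks r | p q ks r. normal_params n p q ks r}"

lemma length_decreasing_le:
  fixes ks :: "nat list"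
  assumes "sorted_wrt (>) ks" "set ks \<subseteq> {p..<q}"
  shows "length ks \<le> q - p"
proof -
  have "distinct ks"
    using assms(1) by (induction ks) auto
  then have "length ks = card (set ks)"
    by (simp add: distinct_card)
  also have "\<dots> \<le> card {p..<q}"
    using assms(2) by (intro card_mono) auto
  finally show ?thesis by simp
qed

lemma decreasing_split:
  fixes ks :: "nat list"
  assumes "sorted_wrt (>) ks"
  obtains hi lo where "ks = hi @ lo" "\<forall>k\<in>set hi. j \<le> k" "\<forall>k\<in>set lo. k < j"
proof
  show "ks = takeWhile (\<lambda>k. j \<le> k) ks @ dropWhile (\<lambda>k. j \<le> k) ks"
    by simp
  show "\<forall>k\<in>set (takeWhile (\<lambda>k. j \<le> k) ks). j \<le> k"
    by (auto dest: set_takeWhileD)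
  show "\<forall>k\<in>set (dropWhile (\<lambda>k. j \<le> k) ks). k < j"
    using assms by (induction ks) auto
qed

section \<open>Left actions satisfying the relations\<close>

text \<open>Words act by composition of unary operators, so that a relation can be applied inside a
longer word by plain equational rewriting, without associativity.\<close>

locale relation_action =
  fixes n :: nat and act :: "letter \<Rightarrow> 'm \<Rightarrow> 'm"
  assumes n_ge_2: "2 \<le> n"
    and relation: "(u, v) \<in> set (relations n) \<Longrightarrow> foldr act u X = foldr act v X"
begin

text \<open>The index 1 is kept as a numeral, since this is how it occurs in the relations.\<close>

declare One_nat_def [simp del]

abbreviation a where "a i \<equiv> act (ga i)"
abbreviation b where "b i \<equiv> act (gb i)"
abbreviation e where "e i \<equiv> act (ge i)"
abbreviation f where "f i \<equiv> act (gf i)"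

lemma a_a_last: "1 \<le> i \<Longrightarrow> i < n \<Longrightarrow> a i (a (n - 1) X) = a i X"
  using relation[of "[ga i, ga (n - 1)]" "[ga i]" X]
  by (auto simp: relations_def R1_def image_iff bex_disj_distrib less_diff_conv)

lemma a_a: "1 \<le> i \<Longrightarrow> i \<le> j \<Longrightarrow> j + 1 < n \<Longrightarrow> a i (a j X) = a (j + 1) (a i X)"
  using relation[of "[ga i, ga j]" "[ga (j + 1), ga i]" X]
  by (auto simp: relations_def R1_def image_iff bex_disj_distrib less_diff_conv)

lemma b_b_first: "1 \<le> i \<Longrightarrow> i < n \<Longrightarrow> b i (b 1 X) = b i X"
  using relation[of "[gb i, gb 1]" "[gb i]" X]
  by (auto simp: relations_def R1b_def image_iff bex_disj_distrib less_diff_conv)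

lemma b_b: "1 \<le> i \<Longrightarrow> i \<le> j \<Longrightarrow> j + 1 < n \<Longrightarrow> b i (b (j + 1) X) = b (j + 1) (b (i + 1) X)"
  using relation[of "[gb i, gb (j + 1)]" "[gb (j + 1), gb (i + 1)]" X]
  by (auto simp: relations_def R1b_def image_iff bex_disj_distrib less_diff_conv)

lemma e_idem: "1 \<le> i \<Longrightarrow> i < n \<Longrightarrow> e i (e i X) = e i X"
  using relation[of "[ge i, ge i]" "[ge i]" X]
  by (auto simp: relations_def R2_def image_iff bex_disj_distrib less_diff_conv)

lemma f_idem: "2 \<le> i \<Longrightarrow> i \<le> n \<Longrightarrow> f i (f i X) = f i X"
proof -
  assume "2 \<le> i" "i \<le> n"
  then obtain k where "i = k + 1" "1 \<le> k" "k < n"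
    by (intro that[of "i - 1"]) auto
  then show ?thesis
    using relation[of "[gf (k + 1), gf (k + 1)]" "[gf (k + 1)]" X] by (auto simp: relations_def R2_def image_iff bex_disj_distrib less_diff_conv)
qed

lemma e_f: "2 \<le> j \<Longrightarrow> j \<le> i \<Longrightarrow> i < n \<Longrightarrow> e i (f j X) = f j (e i X)"
  using relation[of "[ge i, gf j]" "[gf j, ge i]" X]
  by (cases "j = i") (auto simp: relations_def R3_def image_iff bex_disj_distrib less_diff_conv)

lemma f_e_Suc: "1 \<le> i \<Longrightarrow> i < n \<Longrightarrow> f (i + 1) (e i X) = e 1 (f n X)"
  using relation[of "[gf (i + 1), ge i]" "[ge 1, gf n]" X]
  by (auto simp: relations_def R3_def image_iff bex_disj_distrib less_diff_conv)

lemma e_f_Suc: "1 \<le> i \<Longrightarrow> i < n \<Longrightarrow> e i (f (i + 1) X) = e 1 (f n X)"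
  using relation[of "[ge i, gf (i + 1)]" "[gf (i + 1), ge i]" X] f_e_Suc[of i X]
  by (auto simp: relations_def R3_def image_iff bex_disj_distrib less_diff_conv)

lemma e_Suc_e: "1 \<le> i \<Longrightarrow> i + 1 < n \<Longrightarrow> e (i + 1) (e i X) = e i X"
  using relation[of "[ge (i + 1), ge i]" "[ge i]" X]
  by (auto simp: relations_def R3_def image_iff bex_disj_distrib less_diff_conv)

lemma e_e_Suc: "1 \<le> i \<Longrightarrow> i + 1 < n \<Longrightarrow> e i (e (i + 1) X) = e i X"
  using relation[of "[ge i, ge (i + 1)]" "[ge (i + 1), ge i]" X] e_Suc_e[of i X]
  by (auto simp: relations_def R3_def image_iff bex_disj_distrib less_diff_conv)

lemma f_Suc_f: "2 \<le> i \<Longrightarrow> i < n \<Longrightarrow> f (i + 1) (f i X) = f (i + 1) X"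
  using relation[of "[gf (i + 1), gf i]" "[gf (i + 1)]" X]
  by (auto simp: relations_def R3_def image_iff bex_disj_distrib less_diff_conv)

lemma f_f_Suc: "2 \<le> i \<Longrightarrow> i < n \<Longrightarrow> f i (f (i + 1) X) = f (i + 1) X"
  using relation[of "[gf i, gf (i + 1)]" "[gf (i + 1), gf i]" X] f_Suc_f[of i X]
  by (auto simp: relations_def R3_def image_iff bex_disj_distrib less_diff_conv)

lemma a_e_pred: "2 \<le> i \<Longrightarrow> i < n \<Longrightarrow> a i (e (i - 1) X) = e (i - 1) X"
  using relation[of "[ga i, ge (i - 1)]" "[ge (i - 1)]" X]
  by (auto simp: relations_def R4_def image_iff bex_disj_distrib less_diff_conv)

lemma a_e: "1 \<le> i \<Longrightarrow> i \<le> j \<Longrightarrow> j + 1 < n \<Longrightarrow> a i (e j X) = e (j + 1) (a i X)"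
  using relation[of "[ga i, ge j]" "[ge (j + 1), ga i]" X]
  by (auto simp: relations_def R4_def image_iff bex_disj_distrib less_diff_conv)

lemma a_last_e_last: "a (n - 1) (e (n - 1) X) = a (n - 1) X"
  using relation[of "[ga (n - 1), ge (n - 1)]" "[ga (n - 1)]" X]
  by (auto simp: relations_def R4_def image_iff bex_disj_distrib less_diff_conv)

lemma e_a_same: "1 \<le> i \<Longrightarrow> i < n \<Longrightarrow> e i (a i X) = e i X"
  using relation[of "[ge i, ga i]" "[ge i]" X]
  by (auto simp: relations_def R4_def image_iff bex_disj_distrib less_diff_conv)

lemma b_f: "2 \<le> j \<Longrightarrow> j \<le> i \<Longrightarrow> i < n \<Longrightarrow> b i (f (j + 1) X) = f j (b i X)"
  using relation[of "[gb i, gf (j + 1)]" "[gf j, gb i]" X]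
  by (cases "j = i") (auto simp: relations_def R4b_def image_iff bex_disj_distrib less_diff_conv)

lemma b_first_f_2: "b 1 (f 2 X) = b 1 X"
  using relation[of "[gb 1, gf 2]" "[gb 1]" X]
  by (auto simp: relations_def R4b_def image_iff bex_disj_distrib less_diff_conv)

lemma f_b_pred: "1 \<le> i \<Longrightarrow> i < n \<Longrightarrow> f (i + 1) (b i X) = f (i + 1) X"
  using relation[of "[gf (i + 1), gb i]" "[gf (i + 1)]" X]
  by (auto simp: relations_def R4b_def image_iff bex_disj_distrib less_diff_conv)

lemma a_f_le: "2 \<le> j \<Longrightarrow> j \<le> i \<Longrightarrow> i < n \<Longrightarrow> a i (f j X) = f j (a i X)"
  using relation[of "[ga i, gf j]" "[gf j, ga i]" X]
  by (cases "j = i") (auto simp: relations_def R5_def image_iff bex_disj_distrib less_diff_conv)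

lemma a_f_gt: "1 \<le> i \<Longrightarrow> i < j \<Longrightarrow> j < n \<Longrightarrow> a i (f j X) = f (j + 1) (a i X)"
  using relation[of "[ga i, gf j]" "[gf (j + 1), ga i]" X]
  by (auto simp: relations_def R5_def image_iff bex_disj_distrib less_diff_conv)

lemma a_first_f_last: "a 1 (f n X) = e 1 (f n X)"
  using relation[of "[ga 1, gf n]" "[ge 1, gf n]" X]
  by (auto simp: relations_def R5_def image_iff bex_disj_distrib less_diff_conv)

lemma a_last_f_last: "a (n - 1) (f n X) = e 1 (f n X)"
  using relation[of "[ga (n - 1), gf n]" "[ge 1, gf n]" X]
  by (auto simp: relations_def R5_def image_iff bex_disj_distrib less_diff_conv)

lemma b_e: "2 \<le> j \<Longrightarrow> j \<le> i \<Longrightarrow> i < n \<Longrightarrow> b i (e j X) = e (j - 1) (b i X)"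
  using relation[of "[gb i, ge j]" "[ge (j - 1), gb i]" X]
  by (cases "j = i") (auto simp: relations_def R5b_def image_iff bex_disj_distrib less_diff_conv)

lemma b_last_e_first: "b (n - 1) (e 1 X) = f n (e 1 X)"
  using relation[of "[gb (n - 1), ge 1]" "[gf n, ge 1]" X]
  by (auto simp: relations_def R5b_def image_iff bex_disj_distrib less_diff_conv)

lemma f_a_pred: "1 \<le> i \<Longrightarrow> i < n \<Longrightarrow> f (i + 1) (a i X) = f (i + 1) (a 1 X)"
  using relation[of "[gf (i + 1), ga i]" "[gf (i + 1), ga 1]" X]
  by (cases "i = 1") (auto simp: relations_def R6_def image_iff bex_disj_distrib less_diff_conv)

lemma b_a: "1 \<le> i \<Longrightarrow> i < j \<Longrightarrow> j < n \<Longrightarrow> b i (a j X) = a j (b i X)"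
  using relation[of "[gb i, ga j]" "[ga j, gb i]" X]
  by (auto simp: relations_def R7_def image_iff bex_disj_distrib less_diff_conv)

lemma b_a_first: "1 \<le> i \<Longrightarrow> i < n \<Longrightarrow> b i (a 1 X) = a i X"
  using relation[of "[gb i, ga 1]" "[ga i]" X]
  by (auto simp: relations_def R7_def image_iff bex_disj_distrib less_diff_conv)

lemma a_b_last: "1 \<le> i \<Longrightarrow> i < n \<Longrightarrow> a i (b (n - 1) X) = b i X"
  using relation[of "[ga i, gb (n - 1)]" "[gb i]" X]
  by (auto simp: relations_def R7_def image_iff bex_disj_distrib less_diff_conv)

lemma e_e:
  assumes "1 \<le> i" "i \<le> j" "j < n"
  shows "e i (e j X) = e i X" "e j (e i X) = e i X"
proof -
  from assms(2,3) have "\<forall>X. e i (e j X) = e i X \<and> e j (e i X) = e i X"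
  proof (induction j rule: dec_induct)
    case base
    then show ?case using assms(1) by (simp add: e_idem)
  next
    case (step j)
    have "1 \<le> j" "j + 1 < n" using step assms(1) by auto
    then show ?case
      using step.IH step.prems e_e_Suc[of j] e_Suc_e[of j] by (metis Suc_eq_plus1 Suc_lessD)
  qed
  then show "e i (e j X) = e i X" "e j (e i X) = e i X" by auto
qed

lemma f_f:
  assumes "2 \<le> i" "i \<le> j" "j \<le> n"
  shows "f i (f j X) = f j X" "f j (f i X) = f j X"
proof -
  from assms(2,3) have "\<forall>X. f i (f j X) = f j X \<and> f j (f i X) = f j X"
  proof (induction j rule: dec_induct)
    case base
    then show ?case using assms(1) by (simp add: f_idem)
  next
    case (step j)
    have "2 \<le> j" "j < n" using step assms(1) by auto
    then show ?case
      using step.IH f_f_Suc[of j] f_Suc_f[of j] by (metis Suc_eq_plus1 less_imp_le)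
  qed
  then show "f i (f j X) = f j X" "f j (f i X) = f j X" by auto
qed

lemma e_a:
  assumes "1 \<le> i" "i \<le> j" "j < n"
  shows "e i (a j X) = e i X"
  using assms e_e[of i j] e_a_same[of j] by (metis le_trans)

lemma f_b:
  assumes "1 \<le> i" "i < j" "j \<le> n"
  shows "f j (b i X) = f j X"
  using assms f_f(2)[of "i + 1" j "b i X"] f_f(2)[of "i + 1" j X] f_b_pred[of i X] by simp

lemma f_a:
  assumes "1 \<le> i" "i < j" "j \<le> n"
  shows "f j (a i X) = f j (a 1 X)"
  using assms f_f(2)[of "i + 1" j "a i X"] f_f(2)[of "i + 1" j X] f_f(2)[of "i + 1" j "a 1 X"] f_a_pred[of i X] by simp

lemma a_e_lt:
  assumes "1 \<le> j" "j < i" "i < n"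
  shows "a i (e j X) = e j X"
proof -
  have "e (i - 1) (e j X) = e j X"
    using assms by (intro e_e) auto
  then show ?thesis
    using a_e_pred[of i "e j X"] assms by auto
qed

lemma a_e_last: "1 \<le> i \<Longrightarrow> i < n \<Longrightarrow> a i (e (n - 1) X) = a i X"
  by (metis a_a_last a_last_e_last)

section \<open>The zero\<close>

definition zero where "zero X = e 1 (f n X)"

text \<open>The relations list f_(i+1) e_i = e_1 f_n but, for n > 2, not f_n e_1 = e_1 f_n. The latter
follows by inserting f_2 between f_n and e_1: this yields f_n e_1 = f_n (e_1 f_n), and e_1
f_n, being equal to f_n e_(n-1), absorbs f_n from the left.\<close>

lemma f_last_e_first: "f n (e 1 X) = zero X"
proof -
  have zero_fixed: "f n (e 1 (f n Y)) = e 1 (f n Y)" for Y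
    using f_e_Suc[of "n - 1" Y] f_idem[of n "e (n - 1) Y"] n_ge_2 by auto
  have "f n (e 1 X) = f n (f 2 (e 1 X))"
    using n_ge_2 by (simp add: f_f)
  also have "\<dots> = f n (e 1 (f n X))"
    using f_e_Suc[of 1 X] n_ge_2 by (simp add: numeral_2_eq_2)
  finally show ?thesis
    using zero_fixed by (simp add: zero_def)
qed

lemma e_zero: "1 \<le> i \<Longrightarrow> i < n \<Longrightarrow> e i (zero X) = zero X"
  by (simp add: zero_def e_e)

lemma f_zero: "2 \<le> i \<Longrightarrow> i \<le> n \<Longrightarrow> f i (zero X) = zero X"
  by (simp add: f_last_e_first[symmetric] f_f)

text \<open>For i > 1, e_1 absorbs a_i directly. For i = 1, the two expressions e_1 f_n and f_n e_1 of
the zero are combined with a_1 f_n = e_1 f_n.\<close>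

lemma a_zero: "1 \<le> i \<Longrightarrow> i < n \<Longrightarrow> a i (zero X) = zero X"
proof (cases "i = 1")
  case True
  have "a 1 (zero X) = a 1 (f n (e 1 X))" by (simp add: f_last_e_first)
  also have "\<dots> = e 1 (f n (e 1 X))" by (simp only: a_first_f_last)
  also have "\<dots> = e 1 (zero X)" by (simp only: f_last_e_first)
  finally show ?thesis using True n_ge_2 e_zero[of 1 X] by simp
qed (simp add: zero_def a_e_lt)

lemma b_last_zero: "b (n - 1) (zero X) = zero X"
  using n_ge_2 f_zero[of n X] by (simp add: zero_def b_last_e_first)

lemma zero_e: "1 \<le> i \<Longrightarrow> i < n \<Longrightarrow> zero (e i X) = zero X"
  by (simp add: f_last_e_first[symmetric] e_e)

lemma zero_f: "2 \<le> i \<Longrightarrow> i \<le> n \<Longrightarrow> zero (f i X) = zero X"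
  by (simp add: zero_def f_f)

lemma zero_a: "1 \<le> i \<Longrightarrow> i < n \<Longrightarrow> zero (a i X) = zero X"
  by (simp add: f_last_e_first[symmetric] e_a)

lemma zero_b_last: "zero (b (n - 1) X) = zero X"
  using n_ge_2 by (simp add: zero_def f_b)

lemma e_f_lt: "1 \<le> i \<Longrightarrow> i < j \<Longrightarrow> j \<le> n \<Longrightarrow> e i (f j X) = zero X"
proof -
  assume *: "1 \<le> i" "i < j" "j \<le> n"
  have "e i (f j X) = e i (f (i + 1) (f j X))"
    using * by (simp add: f_f)
  then show ?thesis
    using * e_f_Suc[of i "f j X"] zero_f[of j X] by (simp add: zero_def)
qed

lemma f_e_lt: "1 \<le> i \<Longrightarrow> i < j \<Longrightarrow> j \<le> n \<Longrightarrow> f j (e i X) = zero X"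
proof -
  assume *: "1 \<le> i" "i < j" "j \<le> n"
  have "f j (e i X) = f j (f (i + 1) (e i X))"
    using * by (simp add: f_f)
  then show ?thesis
    using * f_e_Suc[of i X] f_zero[of j X] by (simp add: zero_def)
qed

text \<open>Only a_1 f_n and a_(n-1) f_n are given as zero by the relations; the other indices reduce to
n - 1 because a_i = a_i a_(n-1).\<close>

lemma a_f_last: "1 \<le> i \<Longrightarrow> i < n \<Longrightarrow> a i (f n X) = zero X"
  by (metis a_a_last a_last_f_last a_zero zero_def)

section \<open>Products of the generators a\<close>

abbreviation a_prod where "a_prod ks \<equiv> foldr a ks"
abbreviation s_pow where "s_pow u \<equiv> a 1 ^^ u"
abbreviation t_pow where "t_pow v \<equiv> b (n - 1) ^^ v"

lemma zero_a_prod: "set ks \<subseteq> {1..<n} \<Longrightarrow> zero (a_prod ks X) = zero X"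
  by (induction ks) (auto simp: zero_a)

lemma zero_s_pow: "zero (s_pow u X) = zero X"
  using n_ge_2 by (induction u) (auto simp: zero_a)

lemma zero_t_pow: "zero (t_pow v X) = zero X"
  by (induction v) (use zero_b_last in auto)

text \<open>Moving a_j to the right past larger or equal indices raises each of them by one. The index n
- 1 is excluded: it would be raised to n, and a_j a_(n-1) = a_j holds instead.\<close>

lemma a_a_prod:
  "1 \<le> j \<Longrightarrow> set ks \<subseteq> {j..<n - 1} \<Longrightarrow> a j (a_prod ks X) = a_prod (map Suc ks) (a j X)"
  by (induction ks) (use a_a[of j] in \<open>auto simp: Suc_eq_plus1\<close>)

lemma e_a_prod:
  "1 \<le> j \<Longrightarrow> set ks \<subseteq> {j..<n} \<Longrightarrow> e j (a_prod ks X) = e j X"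
  by (induction ks) (auto simp: e_a)

lemma f_a_prod_ge:
  "2 \<le> j \<Longrightarrow> set ks \<subseteq> {j..<n} \<Longrightarrow> f j (a_prod ks X) = a_prod ks (f j X)"
  by (induction ks) (auto simp: a_f_le[symmetric])

text \<open>On the domain {j,...,n}, collapsing below j only shifts, so that every factor acts like s.
After one shift the domain starts at j - 1, and the remaining indices, being smaller than
the first, still lie below it.\<close>

lemma f_a_prod_lt:
  "sorted_wrt (>) ks \<Longrightarrow> set ks \<subseteq> {1..<j} \<Longrightarrow> j \<le> n \<Longrightarrow> f j (a_prod ks X) = f j (s_pow (length ks) X)"
proof (induction ks arbitrary: j)
  case (Cons i ks)
  then have i: "1 \<le> i" "i < j" by auto
  have ks: "set ks \<subseteq> {1..<j - 1}"
  proof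
    fix k assume "k \<in> set ks"
    then have "1 \<le> k" "k < i" using Cons.prems by auto
    then show "k \<in> {1..<j - 1}" using i by simp
  qed
  show ?case
  proof (cases "j = 2")
    case True
    then have "i = 1" "ks = []" using i ks by auto
    then show ?thesis by simp
  next
    case False
    have "f j (a_prod (i # ks) X) = f j (a 1 (a_prod ks X))"
      using f_a[of i j "a_prod ks X"] i Cons.prems(3) by simp
    also have "\<dots> = a 1 (f (j - 1) (a_prod ks X))"
      using i False Cons.prems a_f_gt[of 1 "j - 1"] by simp
    also have "\<dots> = a 1 (f (j - 1) (s_pow (length ks) X))"
      using Cons ks by simp
    also have "\<dots> = f j (a 1 (s_pow (length ks) X))"
      using i False Cons.prems a_f_gt[of 1 "j - 1"] by simp
    finally show ?thesis by simp
  qed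
qed simp

lemma a_prod_a_last:
  "ks \<noteq> [] \<Longrightarrow> set ks \<subseteq> {1..<n} \<Longrightarrow> a_prod ks (a (n - 1) X) = a_prod ks X"
  by (induction ks rule: rev_induct) (auto simp: a_a_last)

text \<open>The relations say how t passes the b's but not the a's, so a_i is expanded as b_i s. Then t
b_i s = b_(i-1) t s = b_(i-1) a_(n-1), and b_(i-1) commutes with a_(n-1) and equals a_(i-1)
t.\<close>

lemma b_last_a:
  assumes "2 \<le> i" "i < n"
  shows "b (n - 1) (a i X) = a (n - 1) (a (i - 1) (b (n - 1) X))"
proof -
  have eqs: "n - 2 + 1 = n - 1" "i - 1 + 1 = i"
    using assms by auto
  have "b (n - 1) (a i X) = b (n - 1) (b i (a 1 X))"
    using assms by (simp add: b_a_first)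
  also have "\<dots> = b (i - 1) (b (n - 1) (a 1 X))"
    using assms b_b[of "i - 1" "n - 2" "a 1 X", unfolded eqs] by auto
  also have "\<dots> = b (i - 1) (a (n - 1) X)"
    using assms by (simp add: b_a_first)
  also have "\<dots> = a (n - 1) (b (i - 1) X)"
    using assms by (simp add: b_a)
  finally show ?thesis
    using assms by (simp add: a_b_last)
qed

text \<open>Each step of moving t to the right produces a further factor a_(n-1). It stands to the right
of some other a and is absorbed there, except for the first one.\<close>

lemma b_last_a_prod:
  "set ks \<subseteq> {2..<n} \<Longrightarrow>
    b (n - 1) (a_prod ks X) = a (n - 1) (a_prod (map (\<lambda>k. k - 1) ks) (b (n - 1) X))"
proof (induction ks)
  case Nil
  then show ?case using n_ge_2 by (simp add: a_b_last)
next
  case (Cons i ks)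
  then have "1 \<le> i - 1" "i - 1 < n" by auto
  then show ?case using Cons by (simp add: b_last_a a_a_last)
qed

text \<open>Below the domain there is room to shift down once more and up again: s t = b_1, which f_i
absorbs for i > 1.\<close>

lemma f_s_pow:
  "u + 2 \<le> j \<Longrightarrow> j \<le> n \<Longrightarrow> f j (s_pow u X) = f j (s_pow (Suc u) (b (n - 1) X))"
proof (induction u arbitrary: j)
  case 0
  have "a 1 (b (n - 1) X) = b 1 X"
    using a_b_last[of 1] n_ge_2 by simp
  then show ?case using 0 by (simp add: f_b)
next
  case (Suc u)
  have f_a_1: "f j (a 1 Y) = a 1 (f (j - 1) Y)" for Y
    using Suc.prems a_f_gt[of 1 "j - 1" Y] by simp
  show ?case
    using Suc by (simp add: f_a_1)
qed

text \<open>This restores the exponent of s that a normal word prescribes when the domain shrinks from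
below.\<close>

lemma f_s_pow_t_pow:
  "u + d + 1 = j \<Longrightarrow> 2 \<le> j \<Longrightarrow> j \<le> n \<Longrightarrow>
    f j (s_pow u (t_pow v X)) = f j (s_pow (j - 1) (t_pow (v + d) X))"
proof (induction d arbitrary: u v)
  case (Suc d)
  have "f j (s_pow u (t_pow v X)) = f j (s_pow (Suc u) (t_pow (Suc v) X))"
    using Suc.prems f_s_pow[of u j "t_pow v X"] by simp
  also have "\<dots> = f j (s_pow (j - 1) (t_pow (Suc v + d) X))"
    using Suc.prems by (intro Suc.IH) auto
  finally show ?case by (simp only: add_Suc_shift)
next
  case 0
  then have "u = j - 1" by simp
  then show ?case by simp
qed

section \<open>Left multiplication of normal words\<close>

text \<open>The prefixes of a normal word; the cuts at the end points 1 and n are trivial.\<close>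

definition cut_below where "cut_below p X = (if p = 1 then X else f p X)"
definition cut_above where "cut_above q X = (if q = n then X else e q X)"

lemma act_normal_word:
  "foldr act (normal_word n p q ks r) X =
    cut_below p (cut_above q (a_prod ks (s_pow (p - 1) (t_pow (r - 1) X))))"
proof -
  have rep: "foldr act (replicate k x) Y = (act x ^^ k) Y" for k x Y
    by (induction k) auto
  have mp: "foldr act (map ga ks) Y = a_prod ks Y" for Y
    by (induction ks) auto
  show ?thesis
    by (simp add: normal_word_def cut_below_def cut_above_def rep mp)
qed

definition reducible :: "letter list \<Rightarrow> bool" where
  "reducible w \<longleftrightarrow> (\<exists>w'\<in>normal_words n. \<forall>X. foldr act w X = foldr act w' X)"

lemma reducible_cong:
  "reducible w' \<Longrightarrow> (\<And>X. foldr act w X = foldr act w' X) \<Longrightarrow> reducible w"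
  by (auto simp: reducible_def)

lemma reducible_zero: "(\<And>X. foldr act w X = zero X) \<Longrightarrow> reducible w"
  unfolding reducible_def normal_words_def by (intro bexI[of _ "[ge 1, gf n]"]) (auto simp: zero_def)

lemma reducible_normal:
  assumes "normal_params n p q ks r"
    "\<And>X. foldr act w X = cut_below p (cut_above q (a_prod ks (s_pow (p - 1) (t_pow (r - 1) X))))"
  shows "reducible w"
  unfolding reducible_def normal_words_def
  by (intro bexI[of _ "normal_word n p q ks r"]) (use assms in \<open>auto simp: act_normal_word\<close>)

text \<open>If j lies in {p,...,q-1}, the domain shrinks to {p,...,j}, and the a's with index at least
j, which come first, are absorbed by e_j.\<close>

lemma reducible_e:
  assumes N: "normal_params n p q ks r" and j: "1 \<le> j" "j < n"
  shows "reducible (ge j # normal_word n p q ks r)"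
proof -
  note N' = N[unfolded normal_params_def]
  consider "j < p" | "p \<le> j" "q \<le> j" | "p \<le> j" "j < q" by linarith
  then show ?thesis
  proof cases
    case 1
    have "set ks \<subseteq> {1..<n}" using N' by auto
    then show ?thesis
      using 1 j N' zero_e[of q]
      by (intro reducible_zero) (auto simp: act_normal_word cut_below_def cut_above_def e_f_lt zero_a_prod zero_s_pow zero_t_pow)
  next
    case 2
    then show ?thesis
      using N' j by (intro reducible_normal[OF N]) (auto simp: act_normal_word cut_below_def cut_above_def e_f e_e)
  next
    case 3
    obtain hi lo where ks: "ks = hi @ lo" "\<forall>k\<in>set hi. j \<le> k" "\<forall>k\<in>set lo. k < j"
      using decreasing_split[of ks] N' by metis
    have hi: "length hi \<le> q - j"
      using ks N' by (intro length_decreasing_le) (auto simp: sorted_wrt_append)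
    show ?thesis
    proof (rule reducible_normal)
      show "normal_params n p j lo r"
        unfolding normal_params_def using ks N' 3 j hi
        by (auto simp: sorted_wrt_append)
    next
      fix X
      have "e j (cut_above q Y) = e j Y" for Y
        using 3 j N' by (auto simp: cut_above_def e_e)
      moreover have "e j (a_prod hi Y) = e j Y" for Y
        using ks N' j by (intro e_a_prod) auto
      ultimately show "foldr act (ge j # normal_word n p q ks r) X =
          cut_below p (cut_above j (a_prod lo (s_pow (p - 1) (t_pow (r - 1) X))))"
        using 3 j N' ks(1) by (auto simp: act_normal_word cut_below_def cut_above_def[of j] e_f)
    qed
  qed
qed

text \<open>If j lies in {p+1,...,q}, the domain shrinks to {j,...,q}. Then f_j passes the a's with
index at least j and turns those with smaller index, which come last, into powers of s. The
image of j is r + (j - p) minus the number of these.\<close>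

lemma reducible_f:
  assumes N: "normal_params n p q ks r" and j: "2 \<le> j" "j \<le> n"
  shows "reducible (gf j # normal_word n p q ks r)"
proof -
  note N' = N[unfolded normal_params_def]
  have f_cut_below: "f j (cut_below p X) = (if j \<le> p then cut_below p X else f j X)" for X
    using j N' by (auto simp: cut_below_def f_f)
  consider "j \<le> p" | "q < j" | "p < j" "j \<le> q" using N' by linarith
  then show ?thesis
  proof cases
    case 1
    then show ?thesis
      by (intro reducible_normal[OF N]) (auto simp: act_normal_word f_cut_below)
  next
    case 2
    have "set ks \<subseteq> {1..<n}" using N' by auto
    then show ?thesis
      using 2 j N'
      by (intro reducible_zero) (auto simp: act_normal_word f_cut_below cut_above_def f_e_lt zero_a_prod zero_s_pow zero_t_pow)
  next
    case 3
    obtain hi lo where ks: "ks = hi @ lo" "\<forall>k\<in>set hi. j \<le> k" "\<forall>k\<in>set lo. k < j"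
      using decreasing_split[of ks] N' by metis
    have lo: "length lo \<le> j - p"
      using ks N' by (intro length_decreasing_le) (auto simp: sorted_wrt_append)
    \<comment> \<open>The increase from the image of p to the image of j.\<close>
    define d where "d = j - p - length lo"
    show ?thesis
    proof (rule reducible_normal)
      show "normal_params n j q hi (r + d)"
        unfolding normal_params_def using ks N' 3 j lo
        by (auto simp: sorted_wrt_append d_def)
    next
      fix X
      let ?T = "t_pow (r - 1) X"
      have e: "f j (cut_above q Y) = cut_above q (f j Y)" for Y
        using 3 j N' by (auto simp: cut_above_def e_f)
      have hi: "f j (a_prod hi Y) = a_prod hi (f j Y)" for Y
        using ks N' j by (intro f_a_prod_ge) auto
      have lo': "f j (a_prod lo Y) = f j (s_pow (length lo) Y)" for Y
        using ks N' j by (intro f_a_prod_lt) (auto simp: sorted_wrt_append)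
      have "f j (s_pow (length lo) (s_pow (p - 1) ?T)) = f j (s_pow (length lo + (p - 1)) ?T)"
        by (simp add: funpow_add)
      also have "\<dots> = f j (s_pow (j - 1) (t_pow (r - 1 + d) X))"
        using lo 3 j N' by (intro f_s_pow_t_pow) (auto simp: d_def)
      finally have "f j (s_pow (length lo) (s_pow (p - 1) ?T)) = f j (s_pow (j - 1) (t_pow (r + d - 1) X))"
        using N' by (simp only: Nat.add_diff_assoc2)
      then show "foldr act (gf j # normal_word n p q ks r) X =
          cut_below j (cut_above q (a_prod hi (s_pow (j - 1) (t_pow (r + d - 1) X))))"
        using 3 j N' ks(1) lo' by (simp add: act_normal_word f_cut_below cut_below_def[of j] e hi)
    qed
  qed
qed

text \<open>For q < n - 1 this is a relation, and for q = n - 1 the cut disappears since a_j e_(n-1) =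
a_j a_(n-1) e_(n-1) = a_j a_(n-1) = a_j.\<close>

lemma a_cut_above:
  assumes "1 \<le> j" "j \<le> q" "j < n" "q \<le> n"
  shows "a j (cut_above q X) = cut_above (min n (q + 1)) (a j X)"
proof -
  consider "q = n" | "q + 1 = n" | "q + 1 < n"
    using assms(4) by linarith
  then show ?thesis
  proof cases
    case 1
    then show ?thesis by (simp add: cut_above_def)
  next
    case 2
    then have "q = n - 1" "q \<noteq> n" "min n (q + 1) = n" by auto
    then show ?thesis using a_e_last[of j X] assms by (simp add: cut_above_def)
  next
    case 3
    then show ?thesis using a_e[of j q X] assms by (simp add: cut_above_def)
  qed
qed

text \<open>If j lies above the domain, nothing changes; if it lies below, a_j acts like s and shifts
the whole domain one step up, which leaves nothing of it if p = n. Otherwise a_j passes the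
larger indices, raising them by one, until it reaches its place in the decreasing sequence.
An index n - 1 would be raised to n; it is removed beforehand by a_j a_(n-1) = a_j.\<close>

lemma reducible_a:
  assumes N: "normal_params n p q ks r" and j: "1 \<le> j" "j < n"
  shows "reducible (ga j # normal_word n p q ks r)"
proof -
  note N' = N[unfolded normal_params_def]
  define q' where "q' = min n (q + 1)"
  \<comment> \<open>If n - 1 occurs in ks at all, then q = n and it is the head of ks.\<close>
  define ks' where "ks' = filter (\<lambda>k. k < n - 1) ks"
  have ks'_len: "length ks \<le> length ks' + (if q = n then 1 else 0)"
  proof -
    have "length (filter (\<lambda>k. \<not> k < n - 1) ks) \<le> q - (n - 1)"
      using N' by (intro length_decreasing_le) (auto intro: sorted_wrt_filter)
    then show ?thesis
      using N' sum_length_filter_compl[of "\<lambda>k. k < n - 1" ks] by (auto simp: ks'_def)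
  qed
  have drop_last: "a i (a_prod ks X) = a i (a_prod ks' X)" if i: "1 \<le> i" "i < n" for i X
  proof (cases ks)
    case Nil
    then show ?thesis by (simp add: ks'_def)
  next
    case (Cons k l)
    have "filter (\<lambda>k. k < n - 1) l = l"
      using N' Cons by (intro filter_True) auto
    moreover have "k = n - 1" if "\<not> k < n - 1"
      using N' that Cons by auto
    ultimately show ?thesis
      using Cons a_a_last[OF i] by (auto simp: ks'_def)
  qed
  consider "q < j" | "p \<le> j" "j \<le> q" | "j < p" "p = n" | "j < p" "p < n" using N' by linarith
  then show ?thesis
  proof cases
    case 1
    then show ?thesis
      using N' j
      by (intro reducible_normal[OF N]) (auto simp: act_normal_word cut_below_def cut_above_def a_f_le a_e_lt)
  next
    case 2
    obtain hi lo where ks: "ks' = hi @ lo" "\<forall>k\<in>set hi. j \<le> k" "\<forall>k\<in>set lo. k < j"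
      using decreasing_split[of ks'] N' by (metis ks'_def sorted_wrt_filter)
    have srt: "sorted_wrt (>) (hi @ lo)"
      using N' unfolding ks(1)[symmetric] ks'_def by (auto intro: sorted_wrt_filter)
    have "\<forall>k\<in>set (hi @ lo). p \<le> k \<and> k < q \<and> Suc k < n"
      using N' unfolding ks(1)[symmetric] ks'_def by auto
    then have bounds: "\<forall>k\<in>set hi. p \<le> k \<and> k < q \<and> Suc k < n" "\<forall>k\<in>set lo. p \<le> k \<and> k < q \<and> Suc k < n"
      by auto
    show ?thesis
    proof (rule reducible_normal)
      have "sorted_wrt (>) (map Suc hi @ j # lo)"
        using srt ks(2,3) by (auto simp: sorted_wrt_append sorted_wrt_map intro: less_SucI)
      moreover have "set (map Suc hi @ j # lo) \<subseteq> {p..<q'}"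
        using bounds 2 j by (auto simp: q'_def less_Suc_eq_le)
      moreover have "r + (q' - p) \<le> n + length (map Suc hi @ j # lo)"
        using N' 2 ks'_len ks(1) by (auto simp: q'_def split: if_splits)
      ultimately show "normal_params n p q' (map Suc hi @ j # lo) r"
        using N' 2 by (simp add: normal_params_def q'_def)
    next
      fix X
      let ?Y = "s_pow (p - 1) (t_pow (r - 1) X)"
      have hi: "a j (a_prod hi Y) = a_prod (map Suc hi) (a j Y)" for Y
        using bounds j ks by (intro a_a_prod) auto
      have "foldr act (ga j # normal_word n p q ks r) X = cut_below p (a j (cut_above q (a_prod ks ?Y)))"
        using 2 j N' by (simp add: act_normal_word cut_below_def a_f_le)
      also have "\<dots> = cut_below p (cut_above q' (a j (a_prod ks ?Y)))"
        using 2 j N' by (simp only: a_cut_above q'_def)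
      also have "\<dots> = cut_below p (cut_above q' (a_prod (map Suc hi @ j # lo) ?Y))"
        using hi j by (simp add: drop_last ks(1))
      finally show "foldr act (ga j # normal_word n p q ks r) X =
          cut_below p (cut_above q' (a_prod (map Suc hi @ j # lo) ?Y))" .
    qed
  next
    case 3
    have "set ks \<subseteq> {1..<n}" using N' by auto
    then show ?thesis
      using 3 j N' zero_e[of q]
      by (intro reducible_zero) (auto simp: act_normal_word cut_below_def a_f_last cut_above_def zero_a_prod zero_s_pow zero_t_pow)
  next
    case 4
    show ?thesis
    proof (rule reducible_normal)
      have "sorted_wrt (>) ks'" using N' by (simp add: ks'_def sorted_wrt_filter)
      then show "normal_params n (p + 1) q' (map Suc ks') r"
        unfolding normal_params_def using N' 4 j ks'_len
        by (auto simp: q'_def sorted_wrt_map ks'_def split: if_splits)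
    next
      fix X
      have "set ks' \<subseteq> {1..<n - 1}"
        using N' by (auto simp: ks'_def)
      then have ks': "a 1 (a_prod ks' Y) = a_prod (map Suc ks') (a 1 Y)" for Y
        using a_a_prod[of 1] by simp
      have "foldr act (ga j # normal_word n p q ks r) X =
          f (p + 1) (a j (cut_above q (a_prod ks (s_pow (p - 1) (t_pow (r - 1) X)))))"
        using 4 j N' by (simp add: act_normal_word cut_below_def a_f_gt)
      also have "\<dots> = f (p + 1) (a 1 (cut_above q (a_prod ks (s_pow (p - 1) (t_pow (r - 1) X)))))"
        using 4 j by (intro f_a) auto
      also have "\<dots> = f (p + 1) (cut_above q' (a_prod (map Suc ks') (a 1 (s_pow (p - 1) (t_pow (r - 1) X)))))"
        using 4 j N' n_ge_2 a_cut_above[of 1 q] drop_last[of 1] ks' by (simp add: q'_def)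
      also have "a 1 (s_pow (p - 1) (t_pow (r - 1) X)) = s_pow (p + 1 - 1) (t_pow (r - 1) X)"
      proof -
        obtain p0 where "p = Suc p0" using N' by (cases p) auto
        then show ?thesis by (simp add: funpow_swap1 Suc_eq_plus1[symmetric] del: Suc_eq_plus1)
      qed
      finally show "foldr act (ga j # normal_word n p q ks r) X =
          cut_below (p + 1) (cut_above q' (a_prod (map Suc ks') (s_pow (p + 1 - 1) (t_pow (r - 1) X))))"
        using N' by (simp add: cut_below_def)
    qed
  qed
qed

text \<open>For p > 2 this is a relation. For p = 2 the cut disappears because t f_2 = t b_1 f_2 = t b_1
= t.\<close>

lemma b_last_cut_below:
  assumes "2 \<le> p" "p \<le> n"
  shows "b (n - 1) (cut_below p X) = cut_below (p - 1) (b (n - 1) X)"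
proof (cases "p = 2")
  case True
  have "b (n - 1) (f 2 X) = b (n - 1) (b 1 (f 2 X))"
    using n_ge_2 b_b_first[of "n - 1" "f 2 X"] by simp
  also have "\<dots> = b (n - 1) X"
    using n_ge_2 b_b_first[of "n - 1" X] by (simp add: b_first_f_2)
  finally show ?thesis
    using True by (simp add: cut_below_def)
next
  case False
  then obtain k where "p = k + 1" "2 \<le> k"
    using assms by (intro that[of "p - 1"]) auto
  then show ?thesis
    using assms b_f[of k "n - 1" X] by (simp add: cut_below_def)
qed

text \<open>The factor a_(n-1) that t leaves behind belongs to the new normal word if q = n, as n - 1
and n are then both mapped to n, and is absorbed by e_(q-1) otherwise. The second equation
disposes of the a_(n-1) = t s that arises when t meets a power of s, or the index 1.\<close>

lemma b_last_cut_above_a_prod: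
  fixes q ks
  assumes "2 \<le> q" "q \<le> n" "set ks \<subseteq> {2..<q}"
  defines "q' \<equiv> if q = n then n else q - 1"
    and "ks' \<equiv> (if q = n then [n - 1] else []) @ map (\<lambda>k. k - 1) ks"
  shows "b (n - 1) (cut_above q (a_prod ks X)) = cut_above q' (a_prod ks' (b (n - 1) X))"
    and "cut_above q' (a_prod ks' (a (n - 1) X)) = cut_above q' (a_prod ks' X)"
proof -
  have "set ks \<subseteq> {2..<n}"
    using assms(2,3) by auto
  then have b_a_prod: "b (n - 1) (a_prod ks X) = a (n - 1) (a_prod (map (\<lambda>k. k - 1) ks) (b (n - 1) X))"
    by (rule b_last_a_prod)
  show "b (n - 1) (cut_above q (a_prod ks X)) = cut_above q' (a_prod ks' (b (n - 1) X))"
  proof (cases "q = n")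
    case False
    then have "b (n - 1) (e q (a_prod ks X)) = e (q - 1) (b (n - 1) (a_prod ks X))"
      using assms(1,2) by (intro b_e) auto
    also have "\<dots> = e (q - 1) (a_prod ks' (b (n - 1) X))"
      using False assms(1,2) e_a[of "q - 1" "n - 1"] by (simp add: b_a_prod ks'_def)
    finally show ?thesis
      using False assms(1,2) by (auto simp: cut_above_def q'_def)
  qed (simp add: b_a_prod cut_above_def q'_def ks'_def)
  have "1 \<le> k - 1 \<and> k - 1 < n" if "k \<in> set ks" for k
    using subsetD[OF assms(3) that] assms(2) by auto
  then have "set ks' \<subseteq> {1..<n}"
    using n_ge_2 by (auto simp: ks'_def)
  then show "cut_above q' (a_prod ks' (a (n - 1) X)) = cut_above q' (a_prod ks' X)"
  proof (cases "ks' = []")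
    case True
    then have "q \<noteq> n" "q' = q - 1"
      by (auto simp: ks'_def q'_def split: if_splits)
    then show ?thesis
      using True assms(1,2) e_a[of "q - 1" "n - 1" X] by (auto simp: cut_above_def)
  qed (use a_prod_a_last in simp)
qed

text \<open>The arithmetic of left multiplication by t: here p' and r' are the new values, and ks
contains the indices other than 1, which t lowers by one.\<close>

lemma normal_params_b_last:
  assumes "1 \<le> p'" "p' < q" "q \<le> n" "sorted_wrt (>) ks" "set ks \<subseteq> {p' + 1..<q}" "1 \<le> r'"
    "r' + (q - (p' + 1)) \<le> n + length ks"
  shows "normal_params n p' (if q = n then n else q - 1)
     ((if q = n then [n - 1] else []) @ map (\<lambda>k. k - 1) ks) r'"
proof -
  have "sorted_wrt (>) (map (\<lambda>k. k - 1) ks)"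
    using assms(4,5) by (induction ks) (auto simp: less_diff_conv2)
  moreover have "k - 1 < q - 1 \<and> k - 1 < q \<and> p' \<le> k - 1" if "k \<in> set ks" for k
    using subsetD[OF assms(5) that] assms(1) by auto
  ultimately show ?thesis
    unfolding normal_params_def using assms(1-3,6-7) by (auto simp: sorted_wrt_append)
qed

text \<open>Both ends of the domain move one step down, except that p = 1 and q = n stay; for q = 1
nothing remains. On its way to the right t turns into a_(n-1), which is then absorbed, when
it meets a_1 or a factor s: it removes a factor of s^(p-1) if p > 1, and the collapse of 1
and 2 if p = 1 and there is one. In the remaining case it increases the exponent of t.\<close>

lemma reducible_b_last:
  assumes N: "normal_params n p q ks r"
  shows "reducible (gb (n - 1) # normal_word n p q ks r)"
proof -
  note N' = N[unfolded normal_params_def]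
  define q' where "q' = (if q = n then n else q - 1)"
  define shifted where "shifted l = (if q = n then [n - 1] else []) @ map (\<lambda>k. k - 1) l" for l :: "nat list"
  note shift = b_last_cut_above_a_prod[of q, folded q'_def shifted_def]
  note params = normal_params_b_last[of _ q _, folded q'_def shifted_def]
  have b_last_a_first: "b (n - 1) (a 1 Y) = a (n - 1) Y" for Y
    using n_ge_2 by (intro b_a_first) auto
  consider "q = 1" | "2 \<le> p" | "p = 1" "2 \<le> q" using N' by linarith
  then show ?thesis
  proof cases
    case 1
    then have "p = 1" "set ks \<subseteq> {1..<n}" "q \<noteq> n" using N' n_ge_2 by auto
    then show ?thesis
      using 1 by (intro reducible_zero)
        (simp add: act_normal_word cut_below_def cut_above_def b_last_e_first f_last_e_first zero_a_prod zero_s_pow zero_t_pow)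
  next
    case 2
    have ks: "set ks \<subseteq> {2..<q}" using N' 2 by auto
    show ?thesis
    proof (rule reducible_normal)
      show "normal_params n (p - 1) q' (shifted ks) r"
        using N' 2 by (intro params) auto
    next
      fix X
      let ?T = "t_pow (r - 1) X"
      obtain m where m: "p - 1 = Suc m" using 2 by (cases "p - 1") auto
      have "foldr act (gb (n - 1) # normal_word n p q ks r) X =
          cut_below (p - 1) (cut_above q' (a_prod (shifted ks) (b (n - 1) (s_pow (p - 1) ?T))))"
        using 2 N' ks by (simp add: act_normal_word b_last_cut_below shift(1))
      also have "b (n - 1) (s_pow (p - 1) ?T) = a (n - 1) (s_pow m ?T)"
        using n_ge_2 by (simp add: m b_a_first)
      finally show "foldr act (gb (n - 1) # normal_word n p q ks r) X =
          cut_below (p - 1) (cut_above q' (a_prod (shifted ks) (s_pow (p - 1 - 1) ?T)))"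
        using 2 N' ks m by (simp add: shift(2))
    qed
  next
    case 3
    obtain hi lo where ks: "ks = hi @ lo" "\<forall>k\<in>set hi. 2 \<le> k" "\<forall>k\<in>set lo. k < 2"
      using decreasing_split[of ks] N' by metis
    have lo1: "\<forall>k\<in>set lo. k = 1" and hi: "set hi \<subseteq> {2..<q}" and srt: "sorted_wrt (>) hi" "sorted_wrt (>) lo"
      using N' 3 ks by (force simp: sorted_wrt_append)+
    have "lo = [] \<or> lo = [1]"
    proof (cases lo)
      case (Cons x l)
      then show ?thesis using lo1 srt(2) by (cases l) auto
    qed simp
    then show ?thesis
    proof
      assume lo: "lo = []"
      show ?thesis
      proof (rule reducible_normal)
        show "normal_params n 1 q' (shifted hi) (r + 1)"
          using N' 3 hi srt lo ks(1) by (intro params) auto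
      next
        fix X
        obtain m where m: "r = Suc m" using N' by (cases r) auto
        show "foldr act (gb (n - 1) # normal_word n p q ks r) X =
            cut_below 1 (cut_above q' (a_prod (shifted hi) (s_pow (1 - 1) (t_pow (r + 1 - 1) X))))"
          using 3 N' hi lo ks(1) by (simp add: act_normal_word cut_below_def shift(1) m flip: Suc_eq_plus1)
      qed
    next
      assume lo: "lo = [1]"
      show ?thesis
      proof (rule reducible_normal)
        show "normal_params n 1 q' (shifted hi) r"
          using N' 3 hi srt lo ks(1) by (intro params) auto
      next
        fix X
        show "foldr act (gb (n - 1) # normal_word n p q ks r) X =
            cut_below 1 (cut_above q' (a_prod (shifted hi) (s_pow (1 - 1) (t_pow (r - 1) X))))"
          using 3 N' hi lo ks(1) b_last_a_first by (simp add: act_normal_word cut_below_def shift)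
      qed
    qed
  qed
qed

lemma reducible_Cons_zero:
  assumes "x \<in> letters n" "\<And>i. x \<noteq> gb i" shows "reducible (x # [ge 1, gf n])"
proof (rule reducible_zero)
  fix X
  show "foldr act (x # [ge 1, gf n]) X = zero X"
    using assms e_zero a_zero f_zero by (auto simp: letters_def zero_def)
qed

text \<open>A letter b_i is first replaced by a_i t.\<close>

lemma reducible_Cons_normal:
  assumes "x \<in> letters n" "w \<in> normal_words n"
  shows "reducible (x # w)"
proof -
  have not_b: "reducible (x # v)" if "x = ga i \<or> x = ge i \<or> x = gf i" "x \<in> letters n" "v \<in> normal_words n" for x i v
  proof -
    from that(3) consider "v = [ge 1, gf n]"
      | p q ks r where "normal_params n p q ks r" "v = normal_word n p q ks r"
      by (auto simp: normal_words_def)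
    then show ?thesis
    proof cases
      case 1
      then show ?thesis using that(1,2) reducible_Cons_zero[of x] by auto
    next
      case 2
      then show ?thesis
        using that(1,2) n_ge_2
        by (elim disjE; hypsubst) (rule reducible_a reducible_e reducible_f; auto simp: letters_def)+
    qed
  qed
  have b_last: "reducible (gb (n - 1) # v)" if "v \<in> normal_words n" for v
    using that b_last_zero reducible_zero[of "[gb (n - 1), ge 1, gf n]"]
    by (auto simp: normal_words_def zero_def intro: reducible_b_last)
  show ?thesis
  proof (cases x)
    case (gb i)
    then have i: "1 \<le> i" "i < n" using assms(1) by (auto simp: letters_def)
    obtain v where v: "v \<in> normal_words n" "\<And>X. foldr act (gb (n - 1) # w) X = foldr act v X"
      using b_last[OF assms(2)] by (auto simp: reducible_def)
    have "ga i \<in> letters n" using i by (auto simp: letters_def)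
    then have "reducible (ga i # v)" using not_b v(1) by blast
    then show ?thesis
    proof (rule reducible_cong)
      fix X
      show "foldr act (x # w) X = foldr act (ga i # v) X"
        using v(2)[of X] a_b_last[OF i, of "foldr act w X"] by (simp add: gb)
    qed
  qed (use assms not_b in blast)+
qed

lemma all_reducible: "w \<in> lists (letters n) \<Longrightarrow> reducible w"
proof (induction w)
  case Nil
  have "normal_params n 1 n [] 1" using n_ge_2 by (simp add: normal_params_def)
  then show ?case
    by (rule reducible_normal) (simp add: cut_below_def cut_above_def)
next
  case (Cons x w)
  then obtain v where v: "v \<in> normal_words n" "\<And>X. foldr act w X = foldr act v X"
    by (auto simp: reducible_def)
  have "reducible (x # v)"
    using Cons v(1) by (intro reducible_Cons_normal) auto
  then show ?case
    by (rule reducible_cong) (simp add: v(2))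
qed

end

section \<open>Order-preserving transformations with interval domain and image\<close>

text \<open>The transformations after which the letters are named.\<close>

fun generator :: "nat \<Rightarrow> letter \<Rightarrow> (nat \<rightharpoonup> nat)" where
  "generator n (ga i) = (\<lambda>x. if 1 \<le> x \<and> x \<le> n then Some (if x \<le> i then x else x - 1) else None)"
| "generator n (gb i) = (\<lambda>x. if 1 \<le> x \<and> x \<le> n then Some (if x \<le> i then x + 1 else x) else None)"
| "generator n (ge i) = (\<lambda>x. if 1 \<le> x \<and> x \<le> i then Some x else None)"
| "generator n (gf i) = (\<lambda>x. if i \<le> x \<and> x \<le> n then Some x else None)"

definition eval_word :: "nat \<Rightarrow> letter list \<Rightarrow> (nat \<rightharpoonup> nat)" where
  "eval_word n w = foldr (\<lambda>x \<alpha>. \<alpha> \<circ>\<^sub>m generator n x) w (Some |` {1..n})"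

lemma eval_word_Nil [simp]: "eval_word n [] = Some |` {1..n}"
  by (simp add: eval_word_def)

lemma eval_word_Cons [simp]: "eval_word n (x # w) = eval_word n w \<circ>\<^sub>m generator n x"
  by (simp add: eval_word_def)

text \<open>Pointwise form of membership, in which the ambient interval no longer occurs in the
convexity conditions.\<close>

lemma mem_PIO_carrier_iff:
  "\<alpha> \<in> PIO_carrier n \<longleftrightarrow>
    (\<forall>x u. \<alpha> x = Some u \<longrightarrow> 1 \<le> x \<and> x \<le> n \<and> 1 \<le> u \<and> u \<le> n) \<and>
    (\<forall>x y u v. \<alpha> x = Some u \<longrightarrow> \<alpha> y = Some v \<longrightarrow> x \<le> y \<longrightarrow> u \<le> v) \<and>
    (\<forall>x y z u w. \<alpha> x = Some u \<longrightarrow> \<alpha> z = Some w \<longrightarrow> x \<le> y \<longrightarrow> y \<le> z \<longrightarrow> (\<exists>v. \<alpha> y = Some v)) \<and>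
    (\<forall>x z u v w. \<alpha> x = Some u \<longrightarrow> \<alpha> z = Some w \<longrightarrow> u \<le> v \<longrightarrow> v \<le> w \<longrightarrow> (\<exists>y. \<alpha> y = Some v))"
    (is "_ \<longleftrightarrow> ?B \<and> ?M \<and> ?D \<and> ?R")
proof -
  have int: "I \<subseteq> {1..n} \<Longrightarrow> is_interval_of n I \<longleftrightarrow>
      (\<forall>x y z. x \<in> I \<longrightarrow> z \<in> I \<longrightarrow> x \<le> y \<longrightarrow> y \<le> z \<longrightarrow> y \<in> I)" for I
    unfolding is_interval_of_def by (meson atLeastAtMost_iff le_trans subsetD)
  have "dom \<alpha> \<subseteq> {1..n} \<and> ran \<alpha> \<subseteq> {1..n} \<longleftrightarrow> ?B"
    by (auto simp: dom_def ran_def subset_eq)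
  moreover have "mono_on (dom \<alpha>) (\<lambda>x. the (\<alpha> x)) \<longleftrightarrow> ?M"
    by (fastforce simp: monotone_on_def)
  moreover have "is_interval_of n (dom \<alpha>) \<longleftrightarrow> ?D" if "dom \<alpha> \<subseteq> {1..n}"
    unfolding int[OF that] by (simp add: dom_def)
  moreover have "is_interval_of n (ran \<alpha>) \<longleftrightarrow> ?R" if "ran \<alpha> \<subseteq> {1..n}"
    unfolding int[OF that] by (simp add: ran_def) blast
  ultimately show ?thesis
    unfolding PIO_carrier_def mem_Collect_eq by argo
qed

text \<open>The domain is the preimage of an interval under a monotone map. For the image, let u < v < w
with u and w attained: a preimage of v under the second map lies, by monotonicity, between
points of the image of the first one, and therefore in that image.\<close>

lemma PIO_carrier_comp:
  assumes A: "\<alpha> \<in> PIO_carrier n" and B: "\<beta> \<in> PIO_carrier n"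
  shows "\<beta> \<circ>\<^sub>m \<alpha> \<in> PIO_carrier n"
proof -
  have comp: "(\<beta> \<circ>\<^sub>m \<alpha>) x = Some z \<longleftrightarrow> (\<exists>y. \<alpha> x = Some y \<and> \<beta> y = Some z)" for x z
    by (auto simp: map_comp_Some_iff)
  note A' = A[unfolded mem_PIO_carrier_iff] and B' = B[unfolded mem_PIO_carrier_iff]
  note monoA = A'[THEN conjunct2, THEN conjunct1, rule_format]
    and monoB = B'[THEN conjunct2, THEN conjunct1, rule_format]
    and domA = A'[THEN conjunct2, THEN conjunct2, THEN conjunct1, rule_format]
    and domB = B'[THEN conjunct2, THEN conjunct2, THEN conjunct1, rule_format]
    and ranA = A'[THEN conjunct2, THEN conjunct2, THEN conjunct2, rule_format]
    and ranB = B'[THEN conjunct2, THEN conjunct2, THEN conjunct2, rule_format]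
  show ?thesis
    unfolding mem_PIO_carrier_iff comp
  proof (intro conjI allI impI; (elim exE conjE)?)
    fix x u y assume "\<alpha> x = Some y" "\<beta> y = Some u"
    then show "1 \<le> x" "x \<le> n" "1 \<le> u" "u \<le> n"
      using A'[THEN conjunct1, rule_format, of x y] B'[THEN conjunct1, rule_format, of y u] by auto
  next
    fix x y u v x1 y1 assume "\<alpha> x = Some x1" "\<beta> x1 = Some u" "\<alpha> y = Some y1" "\<beta> y1 = Some v" "x \<le> y"
    then show "u \<le> v"
      using monoA[of x x1 y y1] monoB[of x1 u y1 v] by simp
  next
    fix x y z u w x1 z1
    assume *: "x \<le> y" "y \<le> z" "\<alpha> x = Some x1" "\<beta> x1 = Some u" "\<alpha> z = Some z1" "\<beta> z1 = Some w"
    then obtain y1 where y1: "\<alpha> y = Some y1" using domA[of x x1 z z1 y] by auto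
    then have "x1 \<le> y1" "y1 \<le> z1" using * monoA by auto
    then obtain v where "\<beta> y1 = Some v" using domB[of x1 u z1 w y1] * by auto
    then show "\<exists>v y1. \<alpha> y = Some y1 \<and> \<beta> y1 = Some v" using y1 by blast
  next
    fix x z u v w x1 z1
    assume *: "u \<le> v" "v \<le> w" "\<alpha> x = Some x1" "\<beta> x1 = Some u" "\<alpha> z = Some z1" "\<beta> z1 = Some w"
    \<comment> \<open>If v is one of the two given values, y1 could lie outside the range of
      \<open>\<alpha>\<close>, so these cases are separated.\<close>
    show "\<exists>y y1. \<alpha> y = Some y1 \<and> \<beta> y1 = Some v"
    proof (cases "v = u \<or> v = w")
      case True
      then show ?thesis using * by blast
    next
      case False
      obtain y1 where y1: "\<beta> y1 = Some v" using ranB[of x1 u z1 w v] * by auto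
      have "x1 \<le> y1" using monoB[of y1 v x1 u] y1 * False by linarith
      moreover have "y1 \<le> z1" using monoB[of z1 w y1 v] y1 * False by linarith
      ultimately obtain y where "\<alpha> y = Some y1" using ranA[of x x1 z z1 y1] * by auto
      then show ?thesis using y1 by blast
    qed
  qed
qed

lemma PIO_carrier_one: "Some |` {1..n} \<in> PIO_carrier n"
proof -
  have "(Some |` {1..n}) x = Some u \<longleftrightarrow> u = x \<and> 1 \<le> x \<and> x \<le> n" for x u
    by (auto simp: restrict_map_def)
  then show ?thesis
    unfolding mem_PIO_carrier_iff by auto
qed

lemma map_comp_one:
  assumes "\<alpha> \<in> PIO_carrier n"
  shows "\<alpha> \<circ>\<^sub>m (Some |` {1..n}) = \<alpha>" "(Some |` {1..n}) \<circ>\<^sub>m \<alpha> = \<alpha>"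
proof -
  have b: "1 \<le> x \<and> x \<le> n \<and> 1 \<le> u \<and> u \<le> n" if "\<alpha> x = Some u" for x u
    using assms that unfolding mem_PIO_carrier_iff by blast
  show "\<alpha> \<circ>\<^sub>m (Some |` {1..n}) = \<alpha>"
    using b by (auto simp: map_comp_def restrict_map_def fun_eq_iff split: option.splits) (metis option.exhaust)+
  show "(Some |` {1..n}) \<circ>\<^sub>m \<alpha> = \<alpha>"
    using b by (auto simp: map_comp_def restrict_map_def fun_eq_iff split: option.splits)
qed

lemma map_comp_assoc: "\<gamma> \<circ>\<^sub>m (\<beta> \<circ>\<^sub>m \<alpha>) = (\<gamma> \<circ>\<^sub>m \<beta>) \<circ>\<^sub>m \<alpha>"
  by (auto simp: map_comp_def fun_eq_iff split: option.splits)

lemma monoid_PIO: "monoid (PIO n)"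
  by standard (simp_all add: PIO_def PIO_carrier_comp PIO_carrier_one map_comp_assoc map_comp_one
    del: One_nat_def)

lemma generator_ge_iff: "generator n (ge i) x = Some y \<longleftrightarrow> y = x \<and> 1 \<le> x \<and> x \<le> i"
  by auto

lemma generator_gf_iff: "generator n (gf i) x = Some y \<longleftrightarrow> y = x \<and> i \<le> x \<and> x \<le> n"
  by auto

lemma generator_in_PIO:
  assumes "x \<in> letters n"
  shows "generator n x \<in> PIO_carrier n"
proof (cases x)
  case (ga i)
  then have i: "1 \<le> i" "i < n" using assms by (auto simp: letters_def)
  show ?thesis
    unfolding mem_PIO_carrier_iff ga
  proof (intro conjI allI impI)
    fix x z u v w assume "generator n (ga i) x = Some u" "generator n (ga i) z = Some w" "u \<le> v" "v \<le> w"
    then show "\<exists>y. generator n (ga i) y = Some v"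
      using i by (intro exI[of _ "if v \<le> i then v else v + 1"]) (auto split: if_splits)
  qed (use i in \<open>auto split: if_splits\<close>)
next
  case (gb i)
  then have i: "1 \<le> i" "i < n" using assms by (auto simp: letters_def)
  show ?thesis
    unfolding mem_PIO_carrier_iff gb
  proof (intro conjI allI impI)
    fix x z u v w assume "generator n (gb i) x = Some u" "generator n (gb i) z = Some w" "u \<le> v" "v \<le> w"
    then show "\<exists>y. generator n (gb i) y = Some v"
      using i by (intro exI[of _ "if v \<le> i + 1 then v - 1 else v"]) (auto split: if_splits)
  qed (use i in \<open>auto split: if_splits\<close>)
next
  case (ge i)
  then have "i < n" using assms by (auto simp: letters_def)
  then show ?thesis
    unfolding mem_PIO_carrier_iff ge generator_ge_iff by auto
next
  case (gf i)
  then have "1 \<le> i" using assms by (auto simp: letters_def)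
  then show ?thesis
    unfolding mem_PIO_carrier_iff gf generator_gf_iff by auto
qed

lemma eval_word_in_PIO: "w \<in> lists (letters n) \<Longrightarrow> eval_word n w \<in> PIO_carrier n"
  by (induction w) (auto simp: PIO_carrier_one generator_in_PIO PIO_carrier_comp simp del: One_nat_def)

lemma eval_word_append:
  "w \<in> lists (letters n) \<Longrightarrow> v \<in> lists (letters n) \<Longrightarrow>
    eval_word n (v @ w) = eval_word n w \<circ>\<^sub>m eval_word n v"
proof (induction v)
  case Nil
  then show ?case using eval_word_in_PIO[of w n] by (simp add: map_comp_one del: One_nat_def)
qed (simp add: map_comp_assoc)

section \<open>Validity and number of the relations\<close>

lemma R1_sound: "(u, v) \<in> set (R1 n) \<Longrightarrow> eval_word n u = eval_word n v"
  by (auto simp: R1_def fun_eq_iff map_comp_def restrict_map_def split: if_splits)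

lemma R1b_sound: "(u, v) \<in> set (R1b n) \<Longrightarrow> eval_word n u = eval_word n v"
  by (auto simp: R1b_def fun_eq_iff map_comp_def restrict_map_def split: if_splits)

lemma R2_sound: "(u, v) \<in> set (R2 n) \<Longrightarrow> eval_word n u = eval_word n v"
  by (auto simp: R2_def fun_eq_iff map_comp_def restrict_map_def split: if_splits)

lemma R3_sound: "(u, v) \<in> set (R3 n) \<Longrightarrow> eval_word n u = eval_word n v"
  by (auto simp: R3_def fun_eq_iff map_comp_def restrict_map_def split: if_splits)

lemma R4_sound: "(u, v) \<in> set (R4 n) \<Longrightarrow> eval_word n u = eval_word n v"
  by (auto simp: R4_def fun_eq_iff map_comp_def restrict_map_def split: if_splits)

lemma R4b_sound: "(u, v) \<in> set (R4b n) \<Longrightarrow> eval_word n u = eval_word n v"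
  by (auto simp: R4b_def fun_eq_iff map_comp_def restrict_map_def split: if_splits)

lemma R5_sound: "2 \<le> n \<Longrightarrow> (u, v) \<in> set (R5 n) \<Longrightarrow> eval_word n u = eval_word n v"
  by (auto simp: R5_def fun_eq_iff map_comp_def restrict_map_def split: if_splits)

lemma R5b_sound: "2 \<le> n \<Longrightarrow> (u, v) \<in> set (R5b n) \<Longrightarrow> eval_word n u = eval_word n v"
  by (auto simp: R5b_def fun_eq_iff map_comp_def restrict_map_def split: if_splits)

lemma R6_sound: "(u, v) \<in> set (R6 n) \<Longrightarrow> eval_word n u = eval_word n v"
  by (auto simp: R6_def fun_eq_iff map_comp_def restrict_map_def split: if_splits)

lemma R6b_sound: "(u, v) \<in> set (R6b n) \<Longrightarrow> eval_word n u = eval_word n v"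
  by (auto simp: R6b_def fun_eq_iff map_comp_def restrict_map_def split: if_splits)

lemma R7_sound: "(u, v) \<in> set (R7 n) \<Longrightarrow> eval_word n u = eval_word n v"
  by (auto simp: R7_def fun_eq_iff map_comp_def restrict_map_def split: if_splits)

lemma relations_sound:
  assumes "2 \<le> n" "(u, v) \<in> set (relations n)"
  shows "eval_word n u = eval_word n v"
  using assms(2) R1_sound R1b_sound R2_sound R3_sound R4_sound R4b_sound R5_sound[OF assms(1)]
    R5b_sound[OF assms(1)] R6_sound R6b_sound R7_sound
  unfolding relations_def set_append Un_iff by metis

lemma mem_letters [simp]:
  "ga i \<in> letters n \<longleftrightarrow> 1 \<le> i \<and> i < n"
  "gb i \<in> letters n \<longleftrightarrow> 1 \<le> i \<and> i < n"
  "ge i \<in> letters n \<longleftrightarrow> 1 \<le> i \<and> i < n"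
  "gf i \<in> letters n \<longleftrightarrow> 2 \<le> i \<and> i \<le> n"
  by (auto simp: letters_def)

lemma R1_letters: "2 \<le> n \<Longrightarrow> set (R1 n) \<subseteq> lists (letters n) \<times> lists (letters n)"
  by (auto simp: R1_def)

lemma R1b_letters: "2 \<le> n \<Longrightarrow> set (R1b n) \<subseteq> lists (letters n) \<times> lists (letters n)"
  by (auto simp: R1b_def)

lemma R2_letters: "2 \<le> n \<Longrightarrow> set (R2 n) \<subseteq> lists (letters n) \<times> lists (letters n)"
  by (auto simp: R2_def)

lemma R3_letters: "2 \<le> n \<Longrightarrow> set (R3 n) \<subseteq> lists (letters n) \<times> lists (letters n)"
  by (auto simp: R3_def)

lemma R4_letters: "2 \<le> n \<Longrightarrow> set (R4 n) \<subseteq> lists (letters n) \<times> lists (letters n)"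
  by (auto simp: R4_def; arith)

lemma R4b_letters: "2 \<le> n \<Longrightarrow> set (R4b n) \<subseteq> lists (letters n) \<times> lists (letters n)"
  by (auto simp: R4b_def)

lemma R5_letters: "2 \<le> n \<Longrightarrow> set (R5 n) \<subseteq> lists (letters n) \<times> lists (letters n)"
  by (auto simp: R5_def)

lemma R5b_letters: "2 \<le> n \<Longrightarrow> set (R5b n) \<subseteq> lists (letters n) \<times> lists (letters n)"
  by (auto simp: R5b_def; arith)

lemma R6_letters: "2 \<le> n \<Longrightarrow> set (R6 n) \<subseteq> lists (letters n) \<times> lists (letters n)"
  by (auto simp: R6_def)

lemma R6b_letters: "2 \<le> n \<Longrightarrow> set (R6b n) \<subseteq> lists (letters n) \<times> lists (letters n)"
  by (auto simp: R6b_def)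

lemma R7_letters: "2 \<le> n \<Longrightarrow> set (R7 n) \<subseteq> lists (letters n) \<times> lists (letters n)"
  by (auto simp: R7_def)

lemma relations_letters:
  "2 \<le> n \<Longrightarrow> set (relations n) \<subseteq> lists (letters n) \<times> lists (letters n)"
  unfolding relations_def set_append
  by (intro Un_least R1_letters R1b_letters R2_letters R3_letters R4_letters R4b_letters
      R5_letters R5b_letters R6_letters R6b_letters R7_letters)

lemma card_letters: "card (letters n) = 4 * n - 4"
proof -
  let ?A = "ga ` {1..n - 1}" and ?B = "gb ` {1..n - 1}" and ?E = "ge ` {1..n - 1}" and ?F = "gf ` {2..n}"
  have "card ?A = n - 1" "card ?B = n - 1" "card ?E = n - 1" "card ?F = n - 1"
    by (simp_all add: card_image inj_on_def)
  moreover have "card (?A \<union> ?B) = card ?A + card ?B"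
    by (rule card_Un_disjoint) auto
  moreover have "card (?A \<union> ?B \<union> ?E) = card (?A \<union> ?B) + card ?E"
    by (rule card_Un_disjoint) auto
  moreover have "card (?A \<union> ?B \<union> ?E \<union> ?F) = card (?A \<union> ?B \<union> ?E) + card ?F"
    by (rule card_Un_disjoint) auto
  ultimately show ?thesis
    unfolding letters_def by (simp only:) arith
qed

lemma sum_falling: "2 * (\<Sum>i\<in>{1..<n::nat}. n - i) = n * (n - 1)"
proof (induction n)
  case (Suc n)
  have "(\<Sum>i\<in>{1..<Suc n}. Suc n - i) = (\<Sum>i\<in>{1..<Suc n}. (n - i) + 1)"
    by (intro sum.cong) auto
  also have "\<dots> = (\<Sum>i\<in>{1..<Suc n}. n - i) + n"
    unfolding sum.distrib by simp
  also have "(\<Sum>i\<in>{1..<Suc n}. n - i) = (\<Sum>i\<in>{1..<n}. n - i)"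
    by (cases "n = 0") simp_all
  finally show ?case
    using Suc by (cases n) (simp_all add: algebra_simps)
qed simp

text \<open>Each of the ten families with two indices has (n - 1)(n - 2) / 2 members. The other
relations form ten families of n - 1, eight families of n - 2 and six single relations.\<close>

lemma length_relations:
  assumes "2 \<le> n"
  shows "length (relations n) = 5 * n\<^sup>2 + 3 * n - 10"
proof -
  obtain m where n: "n = m + 2"
    using assms by (metis le_Suc_ex add.commute)
  define T where "T = (\<Sum>i\<in>{1..<m + 1}. m + 1 - i)"
  have T: "2 * T = m * (m + 1)"
    using sum_falling[of "m + 1"] by (simp add: T_def)
  have falling: "(\<Sum>i\<in>{1..<n - 1}. n - 1 - i) = T"
    by (simp add: T_def n)
  have shorter: "(\<Sum>i\<in>{1..<n}. n - (i + 1)) = T"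
    by (simp add: T_def n)
  have rising: "(\<Sum>i\<in>{2..<n}. i + 1 - 2) = T"
  proof -
    have "2 * (\<Sum>i\<in>{2..<k + 2::nat}. i + 1 - 2) = k * (k + 1)" for k :: nat
      by (induction k) simp_all
    then show ?thesis using T n by (metis mult_cancel1 zero_neq_numeral)
  qed
  have sums: "sum_list (map g [i..<j]) = sum g {i..<j}" for g :: "nat \<Rightarrow> nat" and i j
    by (simp add: interv_sum_list_conv_sum_set_nat)
  have "length (relations n) = 10 * T + 10 * (n - 1) + 8 * (n - 2) + 6"
    unfolding relations_def R1_def R1b_def R2_def R3_def R4_def R4b_def R5_def R5b_def R6_def R6b_def R7_def
    length_append length_concat map_map comp_def length_map length_upt sums falling shorter rising
    by (simp add: sums n)
  also have "\<dots> = 5 * (m * (m + 1)) + 10 * (n - 1) + 8 * (n - 2) + 6"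
    using T by simp
  also have "\<dots> = 5 * n\<^sup>2 + 3 * n - 10"
    by (simp add: n power2_eq_square algebra_simps)
  finally show ?thesis .
qed

section \<open>Normal words as transformations\<close>

lemma eval_word_Cons_apply:
  "eval_word n (x # w) y = (case generator n x y of None \<Rightarrow> None | Some z \<Rightarrow> eval_word n w z)"
  by (simp add: map_comp_def)

text \<open>The number of steps below x at which the transformation does not increase.\<close>

definition collapsed :: "nat list \<Rightarrow> nat \<Rightarrow> nat" where
  "collapsed ks x = length (filter (\<lambda>k. k < x) ks)"

lemma collapsed_Suc:
  "distinct ks \<Longrightarrow> collapsed ks (Suc x) = collapsed ks x + (if x \<in> set ks then 1 else 0)"
  by (induction ks) (auto simp: collapsed_def less_Suc_eq)

lemma collapsed_eq_0: "\<forall>k\<in>set ks. x \<le> k \<Longrightarrow> collapsed ks x = 0"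
  by (force simp: collapsed_def filter_empty_conv)

lemma collapsed_eq_length: "\<forall>k\<in>set ks. k < x \<Longrightarrow> collapsed ks x = length ks"
  by (simp add: collapsed_def)

lemma collapsed_le:
  assumes "sorted_wrt (>) ks" "set ks \<subseteq> {p..<q}"
  shows "collapsed ks x \<le> x - p"
  unfolding collapsed_def
  using assms by (intro length_decreasing_le) (auto intro: sorted_wrt_filter)

lemma decreasing_distinct: "sorted_wrt (>) (ks :: nat list) \<Longrightarrow> distinct ks"
  by (induction ks) auto

text \<open>The indices decrease, so a point above the first index k stays at or above k after the first
step and is moved by all remaining factors as well; a point at or below k is not moved by
the first factor.\<close>

lemma eval_word_a_prod:
  "sorted_wrt (>) ks \<Longrightarrow> set ks \<subseteq> {1..<n} \<Longrightarrow> 1 \<le> y \<Longrightarrow> y \<le> n \<Longrightarrow>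
    eval_word n (map ga ks @ w) y = eval_word n w (y - collapsed ks y)"
proof (induction ks arbitrary: y)
  case Nil
  then show ?case by (simp add: collapsed_def)
next
  case (Cons k ks)
  show ?case
  proof (cases "y \<le> k")
    case True
    then have "collapsed (k # ks) y = collapsed ks y" by (simp add: collapsed_def)
    then show ?thesis
      using Cons True by (simp add: eval_word_Cons_apply del: eval_word_Cons)
  next
    case False
    then have "1 \<le> y - 1" "y - 1 \<le> n" using Cons.prems by auto
    then have IH: "eval_word n (map ga ks @ w) (y - 1) = eval_word n w (y - 1 - collapsed ks (y - 1))"
      using Cons.prems by (intro Cons.IH) auto
    from False have "collapsed (k # ks) y = Suc (length ks)" "collapsed ks (y - 1) = length ks"
      using Cons.prems by (auto simp: collapsed_def intro!: filter_True arg_cong[of _ _ length])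
    then show ?thesis
      using IH Cons.prems False by (simp add: eval_word_Cons_apply del: eval_word_Cons)
  qed
qed

lemma eval_word_s_pow:
  "u < y \<Longrightarrow> y \<le> n \<Longrightarrow> eval_word n (replicate u (ga 1) @ w) y = eval_word n w (y - u)"
  by (induction u arbitrary: y) (simp_all add: eval_word_Cons_apply del: eval_word_Cons)

lemma eval_word_t_pow:
  "1 \<le> y \<Longrightarrow> y + v \<le> n \<Longrightarrow> eval_word n (replicate v (gb (n - 1))) y = Some (y + v)"
  by (induction v arbitrary: y)
    (simp_all add: eval_word_Cons_apply restrict_map_def del: eval_word_Cons)

lemma normal_word_in_letters:
  assumes "normal_params n p q ks r" "2 \<le> n"
  shows "normal_word n p q ks r \<in> lists (letters n)"
proof -
  have "\<forall>k\<in>set ks. 1 \<le> k \<and> k < n"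
    using assms by (auto simp: normal_params_def)
  then have "map ga ks \<in> lists (letters n)"
    by auto
  then show ?thesis
    using assms by (auto simp: normal_params_def normal_word_def)
qed

lemma eval_normal_word:
  assumes N: "normal_params n p q ks r" and n: "2 \<le> n"
  shows "eval_word n (normal_word n p q ks r) x =
    (if p \<le> x \<and> x \<le> q then Some (r + (x - p) - collapsed ks x) else None)"
proof (cases "1 \<le> x \<and> x \<le> n")
  case False
  have "eval_word n (normal_word n p q ks r) \<in> PIO_carrier n"
    using N n by (intro eval_word_in_PIO normal_word_in_letters)
  then have "eval_word n (normal_word n p q ks r) x = None"
    using False unfolding mem_PIO_carrier_iff by (metis option.exhaust)
  then show ?thesis using False N by (auto simp: normal_params_def)
next
  case True
  note N' = N[unfolded normal_params_def]
  let ?w = "map ga ks @ replicate (p - 1) (ga 1) @ replicate (r - 1) (gb (n - 1))"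
  have cut: "eval_word n (normal_word n p q ks r) x = (if p \<le> x \<and> x \<le> q then eval_word n ?w x else None)"
    using True N' by (auto simp: normal_word_def eval_word_Cons_apply simp del: eval_word_Cons)
  show ?thesis
  proof (cases "p \<le> x \<and> x \<le> q")
    case inside: True
    have c: "collapsed ks x \<le> x - p"
      using N' by (intro collapsed_le) auto
    have c': "length ks - collapsed ks x \<le> q - x"
    proof -
      have "length (filter (\<lambda>k. \<not> k < x) ks) \<le> q - x"
        using N' by (intro length_decreasing_le) (auto intro: sorted_wrt_filter)
      then show ?thesis
        using sum_length_filter_compl[of "\<lambda>k. k < x" ks] by (simp add: collapsed_def)
    qed
    have "eval_word n ?w x = eval_word n (replicate (p - 1) (ga 1) @ replicate (r - 1) (gb (n - 1))) (x - collapsed ks x)"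
      using N' True by (intro eval_word_a_prod) auto
    also have "\<dots> = eval_word n (replicate (r - 1) (gb (n - 1))) (x - collapsed ks x - (p - 1))"
      using N' True c inside by (intro eval_word_s_pow) auto
    also have "\<dots> = Some (x - collapsed ks x - (p - 1) + (r - 1))"
      using N' True c c' inside by (intro eval_word_t_pow) arith+
    finally show ?thesis
      using cut inside c N' by auto
  qed (use cut in auto)
qed

lemma decreasing_eqI:
  fixes ks ks' :: "nat list"
  assumes "sorted_wrt (>) ks" "sorted_wrt (>) ks'" "set ks = set ks'"
  shows "ks = ks'"
proof -
  have "rev ks = rev ks'"
    using assms by (intro strict_sorted_equal) (simp_all add: sorted_wrt_rev)
  then show ?thesis by simp
qed

lemma eval_zero_word: "2 \<le> n \<Longrightarrow> eval_word n [ge 1, gf n] = Map.empty"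
  by (auto simp: eval_word_Cons_apply fun_eq_iff simp del: eval_word_Cons)

text \<open>The domain gives p and q, the value at p gives r, and two consecutive points of the domain
have equal values exactly at the indices in the list.\<close>

lemma eval_normal_word_inj:
  assumes N1: "normal_params n p1 q1 ks1 r1" and N2: "normal_params n p2 q2 ks2 r2" and n: "2 \<le> n"
    and eq: "eval_word n (normal_word n p1 q1 ks1 r1) = eval_word n (normal_word n p2 q2 ks2 r2)"
  shows "p1 = p2 \<and> q1 = q2 \<and> ks1 = ks2 \<and> r1 = r2"
proof -
  note N1' = N1[unfolded normal_params_def] and N2' = N2[unfolded normal_params_def]
  have val: "(if p1 \<le> x \<and> x \<le> q1 then Some (r1 + (x - p1) - collapsed ks1 x) else None) =
      (if p2 \<le> x \<and> x \<le> q2 then Some (r2 + (x - p2) - collapsed ks2 x) else None)" for x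
    using fun_cong[OF eq, of x] by (simp only: eval_normal_word[OF N1 n] eval_normal_word[OF N2 n])
  have dom: "p1 \<le> x \<and> x \<le> q1 \<longleftrightarrow> p2 \<le> x \<and> x \<le> q2" for x
    using val[of x] by (auto split: if_splits)
  have p: "p1 = p2" and q: "q1 = q2"
    using dom[of p1] dom[of p2] dom[of q1] dom[of q2] N1' N2' by auto
  have val': "r1 + (x - p1) - collapsed ks1 x = r2 + (x - p1) - collapsed ks2 x" if "p1 \<le> x" "x \<le> q1" for x
    using val[of x] that p q by auto
  have "collapsed ks1 p1 = 0" "collapsed ks2 p1 = 0"
    using N1' N2' p by (auto intro!: collapsed_eq_0)
  then have r: "r1 = r2"
    using val'[of p1] N1' by simp
  have le: "collapsed ks1 x \<le> x - p1" "collapsed ks2 x \<le> x - p1" for x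
    using N1' N2' p by (auto intro!: collapsed_le)
  have same: "collapsed ks1 x = collapsed ks2 x" if "p1 \<le> x" "x \<le> q1" for x
    using val'[OF that] r le[of x] N1' by auto
  have "x \<in> set ks1 \<longleftrightarrow> x \<in> set ks2" if "p1 \<le> x" "x < q1" for x
  proof -
    have "distinct ks1" "distinct ks2"
      using N1' N2' decreasing_distinct by auto
    moreover have "collapsed ks1 x = collapsed ks2 x" "collapsed ks1 (Suc x) = collapsed ks2 (Suc x)"
      using that by (auto intro: same)
    ultimately show ?thesis
      using collapsed_Suc[of ks1 x] collapsed_Suc[of ks2 x] by (simp split: if_splits)
  qed
  then have "set ks1 = set ks2"
    using N1' N2' p q by (auto simp: subset_eq)
  then have "ks1 = ks2"
    using N1' N2' by (intro decreasing_eqI) auto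
  then show ?thesis using p q r by simp
qed

lemma eval_inj_on_normal_words:
  assumes "2 \<le> n"
  shows "inj_on (eval_word n) (normal_words n)"
proof -
  have ne: "eval_word n (normal_word n p q ks r) \<noteq> eval_word n [ge 1, gf n]"
    if N: "normal_params n p q ks r" for p q ks r
  proof -
    have "eval_word n (normal_word n p q ks r) p \<noteq> None"
      using N by (simp add: eval_normal_word[OF N assms] normal_params_def)
    then show ?thesis by (metis eval_zero_word[OF assms])
  qed
  show ?thesis
  proof (rule inj_onI)
    fix u v assume uv: "u \<in> normal_words n" "v \<in> normal_words n" and eq: "eval_word n u = eval_word n v"
    show "u = v"
    proof (cases "u = [ge 1, gf n] \<or> v = [ge 1, gf n]")
      case True
      then show ?thesis using uv eq ne unfolding normal_words_def by fastforce
    next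
      case False
      then obtain p q ks r p' q' ks' r' where
        u: "normal_params n p q ks r" "u = normal_word n p q ks r" and
        v: "normal_params n p' q' ks' r'" "v = normal_word n p' q' ks' r'"
        using uv unfolding normal_words_def by blast
      then show ?thesis
        using eval_normal_word_inj[OF u(1) v(1) assms] eq by simp
    qed
  qed
qed

text \<open>The parameters are read off from the transformation. Its values increase by at most one from
each point of the domain to the next, since a skipped value would not be attained elsewhere
although the image is an interval.\<close>

lemma PIO_carrier_is_eval_normal:
  assumes A: "\<alpha> \<in> PIO_carrier n" and n: "2 \<le> n"
  shows "\<exists>w\<in>normal_words n. eval_word n w = \<alpha>"
proof (cases "\<alpha> = Map.empty")
  case True
  then show ?thesis
    using eval_zero_word[OF n] by (intro bexI[of _ "[ge 1, gf n]"]) (auto simp: normal_words_def)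
next
  case False
  note A' = A[unfolded mem_PIO_carrier_iff]
  note bounds = A'[THEN conjunct1, rule_format]
    and mono = A'[THEN conjunct2, THEN conjunct1, rule_format]
    and convex = A'[THEN conjunct2, THEN conjunct2, THEN conjunct1, rule_format]
    and image = A'[THEN conjunct2, THEN conjunct2, THEN conjunct2, rule_format]
  have "dom \<alpha> \<subseteq> {1..n}" using bounds by fastforce
  then have fin: "finite (dom \<alpha>)" by (rule finite_subset) simp
  have ne: "dom \<alpha> \<noteq> {}" using False by simp
  define p where "p = Min (dom \<alpha>)"
  define q where "q = Max (dom \<alpha>)"
  have "p \<in> dom \<alpha>" "q \<in> dom \<alpha>"
    using fin ne by (simp_all add: p_def q_def del: dom_eq_empty_conv)
  then obtain r s where r: "\<alpha> p = Some r" and s: "\<alpha> q = Some s" by blast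
  have dom: "x \<in> dom \<alpha> \<longleftrightarrow> p \<le> x \<and> x \<le> q" for x
  proof
    assume "p \<le> x \<and> x \<le> q"
    then show "x \<in> dom \<alpha>" using convex[OF r s] by blast
  qed (use fin in \<open>simp add: p_def q_def\<close>)
  define ks where "ks = rev (filter (\<lambda>x. \<alpha> (Suc x) = \<alpha> x) [p..<q])"
  have ks: "sorted_wrt (>) ks" "set ks \<subseteq> {p..<q}"
    by (auto simp: ks_def sorted_wrt_rev intro: sorted_wrt_filter)
  have mem_ks: "x \<in> set ks \<longleftrightarrow> \<alpha> (Suc x) = \<alpha> x" if "p \<le> x" "x < q" for x
    using that by (auto simp: ks_def)
  have val: "\<alpha> x = Some (r + (x - p) - collapsed ks x)" if "p \<le> x" "x \<le> q" for x
    using that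
  proof (induction x rule: dec_induct)
    case base
    have "collapsed ks p = 0" using ks by (auto intro!: collapsed_eq_0)
    then show ?case using r by simp
  next
    case (step x)
    let ?v = "r + (x - p) - collapsed ks x"
    have v: "\<alpha> x = Some ?v" using step by simp
    obtain v' where v': "\<alpha> (Suc x) = Some v'" using dom[of "Suc x"] step by auto
    have c: "collapsed ks x \<le> x - p" using collapsed_le[OF ks] .
    note cS = collapsed_Suc[OF decreasing_distinct[OF ks(1)], of x]
    show ?case
    proof (cases "v' = ?v")
      case True
      then have "x \<in> set ks" using mem_ks[of x] step v v' by simp
      then show ?thesis using v' True cS c step by simp
    next
      case False
      then have "x \<notin> set ks" using mem_ks[of x] step v v' by simp
      moreover have "v' = Suc ?v"
      proof (rule ccontr)
        assume "v' \<noteq> Suc ?v"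
        then have "Suc ?v < v'" using mono[OF v v'] False by simp
        then obtain y where y: "\<alpha> y = Some (Suc ?v)" using image[OF v v', of "Suc ?v"] by auto
        show False
        proof (cases "y \<le> x")
          case True
          then show False using mono[OF y v] by simp
        next
          case False
          then show False using mono[OF v' y] \<open>Suc ?v < v'\<close> by simp
        qed
      qed
      ultimately show ?thesis using v' cS c step by simp
    qed
  qed
  have "collapsed ks q = length ks" using ks by (auto intro!: collapsed_eq_length)
  then have "r + (q - p) \<le> n + length ks"
    using val[of q] s bounds[OF s] dom[of q] by auto
  then have N: "normal_params n p q ks r"
    using ks bounds[OF r] bounds[OF s] dom[of p] r by (auto simp: normal_params_def)
  have "eval_word n (normal_word n p q ks r) = \<alpha>"
  proof
    fix x
    show "eval_word n (normal_word n p q ks r) x = \<alpha> x"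
      using val[of x] dom[of x] by (auto simp: eval_normal_word[OF N n])
  qed
  then show ?thesis using N unfolding normal_words_def by blast
qed

lemma normal_words_letters:
  assumes "2 \<le> n"
  shows "normal_words n \<subseteq> lists (letters n)"
proof -
  have "{normal_word n p q ks r | p q ks r. normal_params n p q ks r} \<subseteq> lists (letters n)"
    using normal_word_in_letters[OF _ assms] by blast
  then show ?thesis using assms by (simp add: normal_words_def)
qed

section \<open>Monoid presentations and the free action\<close>

lemma monoid_free_monoid: "monoid (free_monoid X)"
  by standard (auto simp: free_monoid_def)

text \<open>The isomorphism sends an element to the set of all words that represent it, which is a
congruence class by the condition on the kernel.\<close>

lemma defined_by_presentationI:
  assumes M: "monoid M" and R: "R \<subseteq> lists X \<times> lists X"
    and hom: "\<And>u v. u \<in> lists X \<Longrightarrow> v \<in> lists X \<Longrightarrow> \<phi> (u @ v) = \<phi> u \<otimes>\<^bsub>M\<^esub> \<phi> v"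
    and surj: "\<phi> ` lists X = carrier M"
    and ker: "\<And>u v. u \<in> lists X \<Longrightarrow> v \<in> lists X \<Longrightarrow>
      \<phi> u = \<phi> v \<longleftrightarrow> (u, v) \<in> generated_congruence (free_monoid X) R"
  shows "defined_by_presentation M X R"
proof -
  let ?F = "free_monoid X"
  define r where "r = generated_congruence ?F R"
  have cong: "congruence ?F r"
    unfolding r_def using R
    by (intro congruence_generated_congruence monoid_free_monoid) (simp add: free_monoid_def)
  then have r_lists: "r \<subseteq> lists X \<times> lists X"
    by (simp add: congruence_def equiv_def free_monoid_def)
  define h where "h m = {w \<in> lists X. \<phi> w = m}" for m
  have h: "h (\<phi> w) = r `` {w}" if "w \<in> lists X" for w
  proof -
    have "v \<in> lists X \<and> \<phi> v = \<phi> w \<longleftrightarrow> (w, v) \<in> r" for v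
      using ker[OF that, of v] r_lists unfolding r_def by (metis mem_Sigma_iff subsetD)
    then show ?thesis unfolding h_def by blast
  qed
  have "h \<in> iso M (quotient_monoid ?F r)"
    unfolding iso_def mem_Collect_eq
  proof (intro conjI homI)
    fix x assume "x \<in> carrier M"
    then obtain u where u: "u \<in> lists X" "x = \<phi> u" using surj by blast
    then show "h x \<in> carrier (quotient_monoid ?F r)"
      by (simp add: h quotient_monoid_def quotientI free_monoid_def)
    fix y assume "y \<in> carrier M"
    then obtain v where v: "v \<in> lists X" "y = \<phi> v" using surj by blast
    have "h (x \<otimes>\<^bsub>M\<^esub> y) = r `` {u @ v}"
      using u v hom[of u v] h[of "u @ v"] by simp
    also have "\<dots> = h x \<otimes>\<^bsub>quotient_monoid ?F r\<^esub> h y"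
      using quotient_monoid_mult[OF cong, of u v] u v by (simp add: h free_monoid_def)
    finally show "h (x \<otimes>\<^bsub>M\<^esub> y) = h x \<otimes>\<^bsub>quotient_monoid ?F r\<^esub> h y" .
  next
    have "inj_on h (carrier M)"
    proof (rule inj_onI)
      fix x y assume "x \<in> carrier M" "h x = h y"
      then obtain u where "u \<in> lists X" "\<phi> u = x" using surj by (metis imageE)
      then have "u \<in> h y" unfolding \<open>h x = h y\<close>[symmetric] unfolding h_def by blast
      then show "x = y" using \<open>\<phi> u = x\<close> unfolding h_def by blast
    qed
    moreover have "h ` carrier M = carrier (quotient_monoid ?F r)"
    proof -
      have "h ` carrier M = (\<lambda>w. r `` {w}) ` lists X"
        unfolding surj[symmetric] image_image by (intro image_cong refl h)
      then show ?thesis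
        by (auto simp: quotient_monoid_def quotient_def free_monoid_def)
    qed
    ultimately show "bij_betw h (carrier M) (carrier (quotient_monoid ?F r))"
      by (simp add: bij_betw_def)
  qed
  then show ?thesis
    using M R unfolding defined_by_presentation_def is_iso_def r_def by blast
qed

text \<open>The sets U are arbitrary, so that the action is defined on a whole type. As r relates only
words over X, the words outside \<open>lists X\<close> drop out by themselves. The word l is
nonempty because the empty word acts as the identity, even on sets that are not unions of
classes.\<close>

lemma foldr_left_mult_classes:
  assumes cong: "congruence (free_monoid X) r" and "l \<noteq> []"
  shows "foldr (\<lambda>x U. {v. \<exists>u\<in>U. (x # u, v) \<in> r}) l U = {v. \<exists>u\<in>U. (l @ u, v) \<in> r}"
  using \<open>l \<noteq> []\<close>
proof (induction l rule: list_nonempty_induct)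
  case (cons x l)
  have r: "equiv (lists X) r"
    using cong by (simp add: congruence_def free_monoid_def)
  have append: "(u @ v, u' @ v') \<in> r" if "(u, u') \<in> r" "(v, v') \<in> r" for u u' v v'
    using cong that unfolding congruence_def free_monoid_def by fastforce
  have in_lists: "u \<in> lists X" "v \<in> lists X" if "(u, v) \<in> r" for u v
    using that equiv_type[OF r] by blast+
  have "(\<exists>y. (\<exists>u\<in>U. (l @ u, y) \<in> r) \<and> (x # y, v) \<in> r) \<longleftrightarrow> (\<exists>u\<in>U. (x # l @ u, v) \<in> r)" for v
  proof
    assume "\<exists>y. (\<exists>u\<in>U. (l @ u, y) \<in> r) \<and> (x # y, v) \<in> r"
    then obtain y u where *: "u \<in> U" "(l @ u, y) \<in> r" "(x # y, v) \<in> r" by blast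
    then have "([x], [x]) \<in> r"
      using in_lists(1)[OF *(3)] r by (auto simp: equiv_def refl_on_def)
    then have "(x # l @ u, x # y) \<in> r"
      using append[OF _ *(2)] by fastforce
    then show "\<exists>u\<in>U. (x # l @ u, v) \<in> r"
      using * r by (meson equiv_def transD)
  next
    assume "\<exists>u\<in>U. (x # l @ u, v) \<in> r"
    then obtain u where u: "u \<in> U" "(x # l @ u, v) \<in> r" by blast
    then have "(l @ u, l @ u) \<in> r"
      using in_lists(1)[OF u(2)] r by (auto simp: equiv_def refl_on_def)
    then show "\<exists>y. (\<exists>u\<in>U. (l @ u, y) \<in> r) \<and> (x # y, v) \<in> r"
      using u by blast
  qed
  then show ?case
    using cons.IH by simp
qed simp

lemma relations_nonempty: "(u, v) \<in> set (relations n) \<Longrightarrow> u \<noteq> [] \<and> v \<noteq> []"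
  unfolding relations_def R1_def R1b_def R2_def R3_def R4_def R4b_def R5_def R5b_def R6_def R6b_def R7_def
  by auto

section \<open>The presentation\<close>

text \<open>The letters act on sets of words, and a word sends the class of the empty word to its own
class. Both sides of a relation act alike since neither of them is empty.\<close>

lemma congruent_to_normal_word:
  assumes n: "2 \<le> n" and w: "w \<in> lists (letters n)"
  shows "\<exists>v\<in>normal_words n. (w, v) \<in> generated_congruence (free_monoid (letters n)) (set (relations n))"
proof -
  define X where "X = letters n"
  define r where "r = generated_congruence (free_monoid X) (set (relations n))"
  define act where "act = (\<lambda>x U. {v. \<exists>u\<in>U. (x # u, v) \<in> r})"
  have cong: "congruence (free_monoid X) r"
    unfolding r_def using relations_letters[OF n]
    by (intro congruence_generated_congruence monoid_free_monoid) (simp add: free_monoid_def X_def)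
  then have r: "equiv (lists X) r"
    by (simp add: congruence_def free_monoid_def)
  have foldr_act: "foldr act l U = {v. \<exists>u\<in>U. (l @ u, v) \<in> r}" if "l \<noteq> []" for l U
    unfolding act_def using cong that by (rule foldr_left_mult_classes)
  interpret relation_action n act
  proof
    fix u v U assume uv: "(u, v) \<in> set (relations n)"
    then have "(u, v) \<in> r"
      using subset_generated_congruence unfolding r_def by blast
    have "(u @ x, v @ x) \<in> r" if "x \<in> lists X" for x
    proof -
      have "(x, x) \<in> r" using r that by (simp add: equiv_def refl_on_def)
      then show ?thesis
        using cong \<open>(u, v) \<in> r\<close> unfolding congruence_def free_monoid_def by fastforce
    qed
    moreover have "x \<in> lists X" if "(u @ x, y) \<in> r \<or> (v @ x, y) \<in> r" for x y
      using that equiv_type[OF r] by fastforce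
    ultimately have "(u @ x, y) \<in> r \<longleftrightarrow> (v @ x, y) \<in> r" for x y
      using r by (meson equiv_def symD transD)
    then show "foldr act u U = foldr act v U"
      using relations_nonempty[OF uv] by (simp add: foldr_act)
  qed (rule n)
  define U where "U = r `` {[]}"
  have classes: "foldr act l U = r `` {l}" if l: "l \<in> lists X" for l
  proof (cases "l = []")
    case False
    have "(l @ u, l) \<in> r" if "([], u) \<in> r" for u
    proof -
      have "(l, l) \<in> r" using r l by (simp add: equiv_def refl_on_def)
      then have "(l @ [], l @ u) \<in> r"
        using cong that unfolding congruence_def free_monoid_def by fastforce
      then show ?thesis using r by (simp add: equiv_def symD)
    qed
    moreover have "([], []) \<in> r" using r by (simp add: equiv_def refl_on_def)
    ultimately have "(\<exists>u. ([], u) \<in> r \<and> (l @ u, v) \<in> r) \<longleftrightarrow> (l, v) \<in> r" for v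
      using r by (metis append_Nil2 equiv_def symD transD)
    then show ?thesis
      using False by (auto simp: foldr_act U_def)
  qed (simp add: U_def)
  obtain v where v: "v \<in> normal_words n" "foldr act w U = foldr act v U"
    using all_reducible[OF w] unfolding reducible_def by blast
  then have "v \<in> lists X"
    using normal_words_letters[OF n] by (auto simp: X_def simp del: in_lists_conv_set)
  then have "r `` {w} = r `` {v}"
    using v(2) classes w by (simp add: X_def)
  then have "(w, v) \<in> r"
    using eq_equiv_class[OF _ r \<open>v \<in> lists X\<close>] by blast
  then show ?thesis
    using v(1) by (auto simp: r_def X_def)
qed

text \<open>Having the same value is a congruence that contains the relations.\<close>

lemma generated_congruence_eval:
  assumes n: "2 \<le> n"
    and uv: "(u, v) \<in> generated_congruence (free_monoid (letters n)) (set (relations n))"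
  shows "eval_word n u = eval_word n v"
proof -
  let ?L = "lists (letters n)"
  let ?r = "{(u, v). u \<in> ?L \<and> v \<in> ?L \<and> eval_word n u = eval_word n v}"
  have "congruence (free_monoid (letters n)) ?r"
    unfolding congruence_def
  proof (intro conjI)
    show "equiv (carrier (free_monoid (letters n))) ?r"
      by (rule equivI) (auto simp: free_monoid_def refl_on_def sym_def trans_def simp del: in_lists_conv_set)
  qed (auto simp: free_monoid_def eval_word_append simp del: in_lists_conv_set)
  moreover have "set (relations n) \<subseteq> ?r"
    using relations_letters[OF n] relations_sound[OF n] by (auto simp del: in_lists_conv_set)
  ultimately have "generated_congruence (free_monoid (letters n)) (set (relations n)) \<subseteq> ?r"
    by (rule generated_congruence_least)
  then show ?thesis using uv by blast
qed

theorem theorem31: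
  fixes n :: nat
  assumes "n \<ge> 2"
  shows "defined_by_presentation (PIO n) (letters n) (set (relations n)) \<and>
         card (letters n) = 4 * n - 4 \<and>
         length (relations n) = 5 * n\<^sup>2 + 3 * n - 10"
proof (intro conjI)
  let ?L = "lists (letters n)"
  let ?r = "generated_congruence (free_monoid (letters n)) (set (relations n))"
  have r: "equiv ?L ?r"
    using congruence_generated_congruence[OF monoid_free_monoid, of "set (relations n)" "letters n"]
      relations_letters[OF assms] by (simp add: congruence_def free_monoid_def)
  have normal: "\<exists>v\<in>normal_words n. (w, v) \<in> ?r \<and> eval_word n v = eval_word n w" if "w \<in> ?L" for w
    using congruent_to_normal_word[OF assms that] generated_congruence_eval[OF assms] by metis
  show "defined_by_presentation (PIO n) (letters n) (set (relations n))"
  proof (rule defined_by_presentationI)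
    show "eval_word n (u @ v) = eval_word n u \<otimes>\<^bsub>PIO n\<^esub> eval_word n v" if "u \<in> ?L" "v \<in> ?L" for u v
      using that by (simp add: eval_word_append PIO_def del: in_lists_conv_set)
    show "eval_word n ` ?L = carrier (PIO n)"
      using eval_word_in_PIO PIO_carrier_is_eval_normal[OF _ assms] normal_words_letters[OF assms]
      by (fastforce simp: PIO_def simp del: in_lists_conv_set)
    show "eval_word n u = eval_word n v \<longleftrightarrow> (u, v) \<in> ?r" if "u \<in> ?L" "v \<in> ?L" for u v
    proof
      assume eq: "eval_word n u = eval_word n v"
      obtain u' v' where "u' \<in> normal_words n" "v' \<in> normal_words n" "(u, u') \<in> ?r" "(v, v') \<in> ?r"
        "eval_word n u' = eval_word n u" "eval_word n v' = eval_word n v"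
        using normal \<open>u \<in> ?L\<close> \<open>v \<in> ?L\<close> by metis
      moreover from this have "u' = v'"
        using eval_inj_on_normal_words[OF assms] eq by (metis inj_onD)
      ultimately show "(u, v) \<in> ?r"
        using r by (meson equiv_def symD transD)
    qed (rule generated_congruence_eval[OF assms])
  qed (use monoid_PIO relations_letters[OF assms] in auto)
qed (use assms card_letters length_relations in auto)

end
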